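(* Let $A$ be a unital ring. Denote by $\mathrm{proj}\text{-}A$ the category of finitely generated projective right $A$-modules, let $\mathcal{C}$ be a small full subcategory of $\mathrm{proj}\text{-}A$ with $A_A\in\mathcal{C}_0$, and set $\Gamma:=\mathcal{C}_0\times\mathcal{C}_0$. The following assertions hold: (1) $R_{\mathcal{C}}$ is a right $\Gamma_0$-artinian (resp. right $\Gamma_0$-noetherian) ring if and only if $A$ is a right artinian (resp. right noetherian) ring. (2) $R_{\mathcal{C}}$ is a left $\Gamma_0$-artinian (resp. left $\Gamma_0$-noetherian) ring if and only if $A$ is a left artinian (resp. left noetherian) ring.
   Context: For a set $X$, $X\times X$ is a groupoid: $(z,w)(y,x)$ is defined iff $w=y$, and then $(z,y)(y,x)=(z,x)$; its set of objects (identified with identities) is $\Gamma_0=\{(x,x):x\in X\}$. For $\gamma=(y,x)$, $r(\gamma)=(y,y)$ and $d(\gamma)=(x,x)$. For a small preadditive category $\mathcal{C}$ with set of objects $\mathcal{C}_0$ and morphism groups $\mathcal{C}(X,Y)$ (morphisms $X\to Y$), the ring $R_{\mathcal{C}}:=\bigoplus_{X,Y\in\mathcal{C}_0}\mathcal{C}(X,Y)$ has product $fg:=f\circ g$ if composable and $0$ otherwise (extended bilinearly). It is graded by $\Gamma=\mathcal{C}_0\times\mathcal{C}_0$ via $(R_{\mathcal{C}})_{(X,Y)}:=\mathcal{C}(Y,X)$; for $e=(X,X)\in\Gamma_0$ the identity $1_e$ of $(R_{\mathcal{C}})_e$ is $\mathrm{id}_X$. For a $\Gamma$-graded ring $R=\bigoplus_{\gamma}R_\gamma$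 with identities $1_e\in R_e$ ($e\in\Gamma_0$), graded right (left) submodules are those submodules that are the direct sum of their intersections with the homogeneous components. $R$ is right $\Gamma_0$-artinian (resp. right $\Gamma_0$-noetherian) if for every $e\in\Gamma_0$ the right $R$-module $R(e)=1_eR=\bigoplus_{r(\gamma)=e}R_\gamma$ satisfies the descending (resp. ascending) chain condition on graded right submodules. Left versions: the same for the left module $R1_e=\bigoplus_{d(\gamma)=e}R_\gamma$ for every $e\in\Gamma_0$. *)

theory Defs
  imports "HOL-Algebra.Module" "HOL-Algebra.AbelCoset"
begin

text \<open>
  Conventions. As for \<^const>\<open>abelian_group\<close> in the library, additive groups are carried by ring
  records (or extensions of them), and the fields for multiplication and one are ignored whenever
  only the additive structure is meant.
\<close>


section \<open>Right modules over a ring\<close>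

text \<open>
  The library locale \<^locale>\<open>module\<close> is restricted to commutative rings. A right module reuses
  its record type: \<open>a \<odot>\<^bsub>M\<^esub> x\<close> is read as \<open>x \<cdot> a\<close>, hence the order in
  \<open>smult_assoc\<close>.
  The library locale \<^locale>\<open>submodule\<close> makes no commutativity assumption and
  serves for left and right modules alike.
\<close>

locale right_module = R?: ring R + M?: abelian_group M
  for R :: "('a, 'z) ring_scheme" (structure) and M :: "('a, 'b, 'x) module_scheme" (structure) +
  assumes smult_closed:
      "\<lbrakk> a \<in> carrier R; x \<in> carrier M \<rbrakk> \<Longrightarrow> a \<odot>\<^bsub>M\<^esub> x \<in> carrier M"
    and smult_distr_scalar:
      "\<lbrakk> a \<in> carrier R; b \<in> carrier R; x \<in> carrier M \<rbrakk> \<Longrightarrow>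
        (a \<oplus>\<^bsub>R\<^esub> b) \<odot>\<^bsub>M\<^esub> x = (a \<odot>\<^bsub>M\<^esub> x) \<oplus>\<^bsub>M\<^esub> (b \<odot>\<^bsub>M\<^esub> x)"
    and smult_distr_vector:
      "\<lbrakk> a \<in> carrier R; x \<in> carrier M; y \<in> carrier M \<rbrakk> \<Longrightarrow>
        a \<odot>\<^bsub>M\<^esub> (x \<oplus>\<^bsub>M\<^esub> y) = (a \<odot>\<^bsub>M\<^esub> x) \<oplus>\<^bsub>M\<^esub> (a \<odot>\<^bsub>M\<^esub> y)"
    and smult_assoc:
      "\<lbrakk> a \<in> carrier R; b \<in> carrier R; x \<in> carrier M \<rbrakk> \<Longrightarrow>
        (a \<otimes>\<^bsub>R\<^esub> b) \<odot>\<^bsub>M\<^esub> x = b \<odot>\<^bsub>M\<^esub> (a \<odot>\<^bsub>M\<^esub> x)"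
    and smult_one:
      "x \<in> carrier M \<Longrightarrow> \<one>\<^bsub>R\<^esub> \<odot>\<^bsub>M\<^esub> x = x"

definition right_regular :: "('a, 'z) ring_scheme \<Rightarrow> ('a, 'a) module" where
  "right_regular R = \<lparr> carrier = carrier R, monoid.mult = monoid.mult R, one = one R,
     ring.zero = ring.zero R, ring.add = ring.add R, smult = (\<lambda>a x. x \<otimes>\<^bsub>R\<^esub> a) \<rparr>"

definition left_regular :: "('a, 'z) ring_scheme \<Rightarrow> ('a, 'a) module" where
  "left_regular R = \<lparr> carrier = carrier R, monoid.mult = monoid.mult R, one = one R,
     ring.zero = ring.zero R, ring.add = ring.add R, smult = (\<lambda>a x. a \<otimes>\<^bsub>R\<^esub> x) \<rparr>"

text \<open>Homomorphisms are extensional functions, so that they are equal iff they agree on the carrier.\<close>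

definition rmod_hom ::
  "('a, 'z) ring_scheme \<Rightarrow> ('a, 'b, 'x) module_scheme \<Rightarrow> ('a, 'c, 'y) module_scheme \<Rightarrow> ('b \<Rightarrow> 'c) set"
  where
  "rmod_hom A M N = {f \<in> carrier M \<rightarrow>\<^sub>E carrier N.
     (\<forall>x\<in>carrier M. \<forall>y\<in>carrier M. f (x \<oplus>\<^bsub>M\<^esub> y) = f x \<oplus>\<^bsub>N\<^esub> f y) \<and>
     (\<forall>a\<in>carrier A. \<forall>x\<in>carrier M. f (a \<odot>\<^bsub>M\<^esub> x) = a \<odot>\<^bsub>N\<^esub> f x)}"

definition finitely_generated :: "('a, 'z) ring_scheme \<Rightarrow> ('a, 'b, 'x) module_scheme \<Rightarrow> bool" where
  "finitely_generated A M \<longleftrightarrow>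
     (\<exists>S. finite S \<and> S \<subseteq> carrier M \<and> (\<forall>N. submodule N A M \<and> S \<subseteq> N \<longrightarrow> N = carrier M))"

definition free_right_module :: "('a, 'z) ring_scheme \<Rightarrow> 'i set \<Rightarrow> ('a, 'i \<Rightarrow> 'a) module" where
  "free_right_module A I = \<lparr>
     carrier = {f \<in> I \<rightarrow>\<^sub>E carrier A. finite {i\<in>I. f i \<noteq> \<zero>\<^bsub>A\<^esub>}},
     monoid.mult = undefined, one = undefined,
     ring.zero = (\<lambda>i\<in>I. \<zero>\<^bsub>A\<^esub>),
     ring.add = (\<lambda>f g. \<lambda>i\<in>I. f i \<oplus>\<^bsub>A\<^esub> g i),
     smult = (\<lambda>a f. \<lambda>i\<in>I. f i \<otimes>\<^bsub>A\<^esub> a) \<rparr>"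

text \<open>
  Projective means isomorphic to a direct summand of a free module. If \<open>M\<close> is a direct summand of
  some free module, then it is one of the free module on the set \<open>carrier M\<close>; therefore it is no
  restriction that the basis \<open>I\<close> ranges over subsets of the type of elements of \<open>M\<close>.
\<close>

definition projective :: "('a, 'z) ring_scheme \<Rightarrow> ('a, 'b, 'x) module_scheme \<Rightarrow> bool" where
  "projective A M \<longleftrightarrow>
     (\<exists>(I :: 'b set) P Q \<phi>. let F = free_right_module A I in
        submodule P A F \<and> submodule Q A F \<and>
        P <+>\<^bsub>F\<^esub> Q = carrier F \<and> P \<inter> Q = {\<zero>\<^bsub>F\<^esub>} \<and>
        \<phi> \<in> rmod_hom A M (F\<lparr>carrier := P\<rparr>) \<and> bij_betw \<phi> (carrier M) P)"


section \<open>Chain conditions\<close>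

definition dcc_on :: "'x set set \<Rightarrow> bool" where
  "dcc_on \<S> \<longleftrightarrow>
     (\<forall>N :: nat \<Rightarrow> 'x set. range N \<subseteq> \<S> \<and> antimono N \<longrightarrow> (\<exists>k. \<forall>n\<ge>k. N n = N k))"

definition acc_on :: "'x set set \<Rightarrow> bool" where
  "acc_on \<S> \<longleftrightarrow>
     (\<forall>N :: nat \<Rightarrow> 'x set. range N \<subseteq> \<S> \<and> mono N \<longrightarrow> (\<exists>k. \<forall>n\<ge>k. N n = N k))"

definition right_artinian :: "('a, 'z) ring_scheme \<Rightarrow> bool" where
  "right_artinian A \<longleftrightarrow> dcc_on {I. submodule I A (right_regular A)}"

definition right_noetherian :: "('a, 'z) ring_scheme \<Rightarrow> bool" where
  "right_noetherian A \<longleftrightarrow> acc_on {I. submodule I A (right_regular A)}"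

definition left_artinian :: "('a, 'z) ring_scheme \<Rightarrow> bool" where
  "left_artinian A \<longleftrightarrow> dcc_on {I. submodule I A (left_regular A)}"

definition left_noetherian :: "('a, 'z) ring_scheme \<Rightarrow> bool" where
  "left_noetherian A \<longleftrightarrow> acc_on {I. submodule I A (left_regular A)}"


section \<open>Rings graded by a groupoid \<open>X \<times> X\<close>\<close>

definition groupoid_ids :: "'o set \<Rightarrow> ('o \<times> 'o) set" where
  "groupoid_ids X = {(x, x) | x. x \<in> X}"

text \<open>
  A ring graded by \<open>\<Gamma> = X \<times> X\<close>, where \<open>X\<close> is the field \<open>base\<close>; \<open>homog \<gamma>\<close> is the component of
  degree \<open>\<gamma>\<close> and \<open>unit_at e\<close> is \<open>1\<^sub>e\<close>. The ring need not be unital: the field \<^const>\<open>one\<close> is ignored.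
\<close>

record ('o, 'r) graded_ring = "'r ring" +
  base :: "'o set"
  homog :: "'o \<times> 'o \<Rightarrow> 'r set"
  unit_at :: "'o \<times> 'o \<Rightarrow> 'r"

text \<open>The canonical map from the external direct sum of the \<open>H i\<close> is a bijection onto \<open>N\<close>.\<close>

definition internal_direct_sum ::
  "('r, 'x) ring_scheme \<Rightarrow> 'i set \<Rightarrow> ('i \<Rightarrow> 'r set) \<Rightarrow> 'r set \<Rightarrow> bool" where
  "internal_direct_sum G I H N \<longleftrightarrow>
     bij_betw (\<lambda>c. \<Oplus>\<^bsub>G\<^esub>i\<in>{i\<in>I. c i \<noteq> \<zero>\<^bsub>G\<^esub>}. c i)
       {c \<in> (\<Pi>\<^sub>E i\<in>I. H i). finite {i\<in>I. c i \<noteq> \<zero>\<^bsub>G\<^esub>}} N"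

text \<open>The right module \<open>R(e) = 1\<^sub>e R\<close> and the left module \<open>R 1\<^sub>e\<close>.\<close>

definition right_module_at :: "('o, 'r, 'x) graded_ring_scheme \<Rightarrow> 'o \<times> 'o \<Rightarrow> ('r, 'r) module" where
  "right_module_at R e = (right_regular R)\<lparr>carrier := (\<lambda>x. unit_at R e \<otimes>\<^bsub>R\<^esub> x) ` carrier R\<rparr>"

definition left_module_at :: "('o, 'r, 'x) graded_ring_scheme \<Rightarrow> 'o \<times> 'o \<Rightarrow> ('r, 'r) module" where
  "left_module_at R e = (left_regular R)\<lparr>carrier := (\<lambda>x. x \<otimes>\<^bsub>R\<^esub> unit_at R e) ` carrier R\<rparr>"

definition graded_submodule ::
  "'r set \<Rightarrow> ('o, 'r, 'x) graded_ring_scheme \<Rightarrow> ('r, 'r) module \<Rightarrow> bool" where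
  "graded_submodule N R M \<longleftrightarrow>
     submodule N R M \<and>
     internal_direct_sum R (base R \<times> base R) (\<lambda>\<gamma>. N \<inter> homog R \<gamma>) N"

definition right_gr_artinian :: "('o, 'r, 'x) graded_ring_scheme \<Rightarrow> bool" where
  "right_gr_artinian R \<longleftrightarrow>
     (\<forall>e\<in>groupoid_ids (base R). dcc_on {N. graded_submodule N R (right_module_at R e)})"

definition right_gr_noetherian :: "('o, 'r, 'x) graded_ring_scheme \<Rightarrow> bool" where
  "right_gr_noetherian R \<longleftrightarrow>
     (\<forall>e\<in>groupoid_ids (base R). acc_on {N. graded_submodule N R (right_module_at R e)})"

definition left_gr_artinian :: "('o, 'r, 'x) graded_ring_scheme \<Rightarrow> bool" where
  "left_gr_artinian R \<longleftrightarrow>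
     (\<forall>e\<in>groupoid_ids (base R). dcc_on {N. graded_submodule N R (left_module_at R e)})"

definition left_gr_noetherian :: "('o, 'r, 'x) graded_ring_scheme \<Rightarrow> bool" where
  "left_gr_noetherian R \<longleftrightarrow>
     (\<forall>e\<in>groupoid_ids (base R). acc_on {N. graded_submodule N R (left_module_at R e)})"


section \<open>Preadditive categories and their rings\<close>

text \<open>
  \<open>Mor C X Y\<close> is the group of morphisms \<open>X \<rightarrow> Y\<close>. Morphism groups need not be disjoint, so
  composition takes the objects as arguments: \<open>Comp C X Y Z g f\<close> is \<open>g \<circ> f\<close> for
  \<open>f : X \<rightarrow> Y\<close> and \<open>g : Y \<rightarrow> Z\<close>.
\<close>

record ('o, 'm) cat =
  Ob :: "'o set"
  Mor :: "'o \<Rightarrow> 'o \<Rightarrow> 'm ring"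
  Comp :: "'o \<Rightarrow> 'o \<Rightarrow> 'o \<Rightarrow> 'm \<Rightarrow> 'm \<Rightarrow> 'm"
  Ident :: "'o \<Rightarrow> 'm"

locale preadditive_category =
  fixes C :: "('o, 'm) cat"
  assumes Mor_group: "\<lbrakk> X \<in> Ob C; Y \<in> Ob C \<rbrakk> \<Longrightarrow> abelian_group (Mor C X Y)"
    and Comp_closed:
      "\<lbrakk> X \<in> Ob C; Y \<in> Ob C; Z \<in> Ob C; f \<in> carrier (Mor C X Y); g \<in> carrier (Mor C Y Z) \<rbrakk> \<Longrightarrow>
        Comp C X Y Z g f \<in> carrier (Mor C X Z)"
    and Comp_assoc:
      "\<lbrakk> W \<in> Ob C; X \<in> Ob C; Y \<in> Ob C; Z \<in> Ob C;
         f \<in> carrier (Mor C W X); g \<in> carrier (Mor C X Y); h \<in> carrier (Mor C Y Z) \<rbrakk> \<Longrightarrow>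
        Comp C W X Z (Comp C X Y Z h g) f = Comp C W Y Z h (Comp C W X Y g f)"
    and Ident_closed: "X \<in> Ob C \<Longrightarrow> Ident C X \<in> carrier (Mor C X X)"
    and Ident_left:
      "\<lbrakk> X \<in> Ob C; Y \<in> Ob C; f \<in> carrier (Mor C X Y) \<rbrakk> \<Longrightarrow> Comp C X Y Y (Ident C Y) f = f"
    and Ident_right:
      "\<lbrakk> X \<in> Ob C; Y \<in> Ob C; f \<in> carrier (Mor C X Y) \<rbrakk> \<Longrightarrow> Comp C X X Y f (Ident C X) = f"
    and Comp_add_right:
      "\<lbrakk> X \<in> Ob C; Y \<in> Ob C; Z \<in> Ob C;
         f \<in> carrier (Mor C X Y); f' \<in> carrier (Mor C X Y); g \<in> carrier (Mor C Y Z) \<rbrakk> \<Longrightarrow>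
        Comp C X Y Z g (f \<oplus>\<^bsub>Mor C X Y\<^esub> f') =
        Comp C X Y Z g f \<oplus>\<^bsub>Mor C X Z\<^esub> Comp C X Y Z g f'"
    and Comp_add_left:
      "\<lbrakk> X \<in> Ob C; Y \<in> Ob C; Z \<in> Ob C;
         f \<in> carrier (Mor C X Y); g \<in> carrier (Mor C Y Z); g' \<in> carrier (Mor C Y Z) \<rbrakk> \<Longrightarrow>
        Comp C X Y Z (g \<oplus>\<^bsub>Mor C Y Z\<^esub> g') f =
        Comp C X Y Z g f \<oplus>\<^bsub>Mor C X Z\<^esub> Comp C X Y Z g' f"

definition full_subcategory :: "('o, 'm) cat \<Rightarrow> 'o set \<Rightarrow> ('o, 'm) cat" where
  "full_subcategory C S = C\<lparr>Ob := S\<rparr>"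

text \<open>
  The ring of \<open>C\<close>: finitely supported families \<open>f\<close> with \<open>f (X, Y)\<close> a morphism \<open>Y \<rightarrow> X\<close>. Since
  \<open>f (X, Y)\<close> and \<open>g (Y', Z)\<close> are composable exactly if \<open>Y = Y'\<close>, the product is matrix
  multiplication; its sum is taken over a finite set containing all nonzero summands.
\<close>

definition cat_ring :: "('o, 'm) cat \<Rightarrow> ('o, 'o \<times> 'o \<Rightarrow> 'm) graded_ring" where
  "cat_ring C =
    (let \<Gamma> = Ob C \<times> Ob C;
         comp = (\<lambda>\<gamma>. Mor C (snd \<gamma>) (fst \<gamma>));
         car = {f \<in> (\<Pi>\<^sub>E \<gamma>\<in>\<Gamma>. carrier (comp \<gamma>)). finite {\<gamma>\<in>\<Gamma>. f \<gamma> \<noteq> \<zero>\<^bsub>comp \<gamma>\<^esub>}}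
     in \<lparr>
       carrier = car,
       monoid.mult = (\<lambda>f g. \<lambda>(X, Z)\<in>\<Gamma>.
         \<Oplus>\<^bsub>Mor C Z X\<^esub>Y\<in>{Y\<in>Ob C. f (X, Y) \<noteq> \<zero>\<^bsub>Mor C Y X\<^esub>}. Comp C Z Y X (f (X, Y)) (g (Y, Z))),
       one = undefined,
       ring.zero = (\<lambda>\<gamma>\<in>\<Gamma>. \<zero>\<^bsub>comp \<gamma>\<^esub>),
       ring.add = (\<lambda>f g. \<lambda>\<gamma>\<in>\<Gamma>. f \<gamma> \<oplus>\<^bsub>comp \<gamma>\<^esub> g \<gamma>),
       base = Ob C,
       homog = (\<lambda>\<gamma>. {f \<in> car. \<forall>\<delta>\<in>\<Gamma>. \<delta> \<noteq> \<gamma> \<longrightarrow> f \<delta> = \<zero>\<^bsub>comp \<delta>\<^esub>}),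
       unit_at = (\<lambda>e. \<lambda>\<gamma>\<in>\<Gamma>. if \<gamma> = e then Ident C (fst e) else \<zero>\<^bsub>comp \<gamma>\<^esub>) \<rparr>)"


section \<open>The category of finitely generated projective right modules\<close>

definition hom_group ::
  "('a, 'z) ring_scheme \<Rightarrow> ('a, 'b) module \<Rightarrow> ('a, 'b) module \<Rightarrow> ('b \<Rightarrow> 'b) ring" where
  "hom_group A M N = \<lparr>
     carrier = rmod_hom A M N,
     monoid.mult = undefined, one = undefined,
     ring.zero = (\<lambda>x\<in>carrier M. \<zero>\<^bsub>N\<^esub>),
     ring.add = (\<lambda>f g. \<lambda>x\<in>carrier M. f x \<oplus>\<^bsub>N\<^esub> g x) \<rparr>"

text \<open>
  The modules have their elements in a fixed type \<open>'b\<close>. Taking \<open>'b = 'a\<close> makes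
  \<^term>\<open>right_regular A\<close> an object. This does not restrict sizes: \<open>carrier A\<close> may be a small
  subset of \<open>'a\<close>, so \<open>'a\<close> can be chosen to accommodate any given set of modules.
\<close>

definition proj_cat :: "('a, 'z) ring_scheme \<Rightarrow> (('a, 'b) module, 'b \<Rightarrow> 'b) cat" where
  "proj_cat A = \<lparr>
     Ob = {M. right_module A M \<and> finitely_generated A M \<and> projective A M},
     Mor = hom_group A,
     Comp = (\<lambda>M N P g f. compose (carrier M) g f),
     Ident = (\<lambda>M. \<lambda>x\<in>carrier M. x) \<rparr>"

lemma rmod_hom_closed: "\<lbrakk> f \<in> rmod_hom A M N; x \<in> carrier M \<rbrakk> \<Longrightarrow> f x \<in> carrier N"
  by (auto simp: rmod_hom_def)

lemma rmod_homI:
  assumes "\<And>x. x \<in> carrier M \<Longrightarrow> f x \<in> carrier N" "f \<in> extensional (carrier M)"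
    and "\<And>x y. \<lbrakk> x \<in> carrier M; y \<in> carrier M \<rbrakk> \<Longrightarrow> f (x \<oplus>\<^bsub>M\<^esub> y) = f x \<oplus>\<^bsub>N\<^esub> f y"
    and "\<And>a x. \<lbrakk> a \<in> carrier A; x \<in> carrier M \<rbrakk> \<Longrightarrow> f (a \<odot>\<^bsub>M\<^esub> x) = a \<odot>\<^bsub>N\<^esub> f x"
  shows "f \<in> rmod_hom A M N"
  using assms by (auto simp: rmod_hom_def PiE_def)

lemma rmod_hom_ext:
  assumes "f \<in> rmod_hom A M N" "g \<in> rmod_hom A M N" "\<And>x. x \<in> carrier M \<Longrightarrow> f x = g x"
  shows "f = g"
  using assms by (auto simp: rmod_hom_def intro: PiE_ext)

lemma (in right_module) smult_zero:
  assumes "a \<in> carrier R" shows "a \<odot>\<^bsub>M\<^esub> \<zero>\<^bsub>M\<^esub> = \<zero>\<^bsub>M\<^esub>"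
proof -
  have "a \<odot>\<^bsub>M\<^esub> \<zero>\<^bsub>M\<^esub> = (a \<odot>\<^bsub>M\<^esub> \<zero>\<^bsub>M\<^esub>) \<oplus>\<^bsub>M\<^esub> (a \<odot>\<^bsub>M\<^esub> \<zero>\<^bsub>M\<^esub>)"
    using smult_distr_vector[OF assms M.zero_closed M.zero_closed] by simp
  then show ?thesis
    using smult_closed[OF assms M.zero_closed] M.add.l_cancel_one' by fastforce
qed

lemma (in right_module) smult_minus:
  assumes "a \<in> carrier R" "x \<in> carrier M" shows "a \<odot>\<^bsub>M\<^esub> (\<ominus>\<^bsub>M\<^esub> x) = \<ominus>\<^bsub>M\<^esub> (a \<odot>\<^bsub>M\<^esub> x)"
proof -
  have "(a \<odot>\<^bsub>M\<^esub> (\<ominus>\<^bsub>M\<^esub> x)) \<oplus>\<^bsub>M\<^esub> (a \<odot>\<^bsub>M\<^esub> x) = \<zero>\<^bsub>M\<^esub>"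
    using smult_distr_vector[OF assms(1), of "\<ominus>\<^bsub>M\<^esub> x" x] assms smult_zero
    by (simp add: M.l_neg)
  then show ?thesis
    using assms smult_closed by (simp add: M.minus_equality)
qed

lemma abelian_group_hom_group:
  assumes "right_module A M" "right_module A N"
  shows "abelian_group (hom_group A M N)"
proof -
  interpret M: right_module A M by fact
  interpret N: right_module A N by fact
  note simps = hom_group_def N.a_ac N.smult_closed N.smult_distr_vector rmod_hom_closed
  show ?thesis
  proof (rule abelian_groupI)
    fix f g assume "f \<in> carrier (hom_group A M N)" "g \<in> carrier (hom_group A M N)"
    then have fg: "f \<in> rmod_hom A M N" "g \<in> rmod_hom A M N" by (auto simp: hom_group_def)
    then have *: "f (x \<oplus>\<^bsub>M\<^esub> y) = f x \<oplus>\<^bsub>N\<^esub> f y" "g (x \<oplus>\<^bsub>M\<^esub> y) = g x \<oplus>\<^bsub>N\<^esub> g y"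
      "a \<in> carrier A \<Longrightarrow> f (a \<odot>\<^bsub>M\<^esub> x) = a \<odot>\<^bsub>N\<^esub> f x"
      "a \<in> carrier A \<Longrightarrow> g (a \<odot>\<^bsub>M\<^esub> x) = a \<odot>\<^bsub>N\<^esub> g x"
      if "x \<in> carrier M" "y \<in> carrier M" for a x y
      using that by (auto simp: rmod_hom_def)
    have "(\<lambda>x\<in>carrier M. f x \<oplus>\<^bsub>N\<^esub> g x) \<in> rmod_hom A M N"
      by (rule rmod_homI) (use fg in \<open>auto simp: * simps M.smult_closed\<close>)
    then show "f \<oplus>\<^bsub>hom_group A M N\<^esub> g \<in> carrier (hom_group A M N)"
      by (simp add: hom_group_def)
    show "f \<oplus>\<^bsub>hom_group A M N\<^esub> g = g \<oplus>\<^bsub>hom_group A M N\<^esub> f"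
      using fg by (auto simp: simps intro!: restrict_ext)
    fix h assume "h \<in> carrier (hom_group A M N)"
    then have "h \<in> rmod_hom A M N" by (auto simp: hom_group_def)
    with fg show "f \<oplus>\<^bsub>hom_group A M N\<^esub> g \<oplus>\<^bsub>hom_group A M N\<^esub> h =
        f \<oplus>\<^bsub>hom_group A M N\<^esub> (g \<oplus>\<^bsub>hom_group A M N\<^esub> h)"
      by (auto simp: simps intro!: restrict_ext)
  next
    have "(\<lambda>x\<in>carrier M. \<zero>\<^bsub>N\<^esub>) \<in> rmod_hom A M N"
      by (rule rmod_homI) (auto simp: M.smult_closed N.smult_zero)
    then show "\<zero>\<^bsub>hom_group A M N\<^esub> \<in> carrier (hom_group A M N)"
      by (simp add: hom_group_def)
  next
    fix f assume "f \<in> carrier (hom_group A M N)"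
    then have f: "f \<in> rmod_hom A M N" by (auto simp: hom_group_def)
    then have ext: "f \<in> extensional (carrier M)" by (auto simp: rmod_hom_def PiE_def)
    show "\<zero>\<^bsub>hom_group A M N\<^esub> \<oplus>\<^bsub>hom_group A M N\<^esub> f = f"
      using f by (intro extensionalityI[OF _ ext]) (auto simp: simps)
    have *: "f (x \<oplus>\<^bsub>M\<^esub> y) = f x \<oplus>\<^bsub>N\<^esub> f y"
      "a \<in> carrier A \<Longrightarrow> f (a \<odot>\<^bsub>M\<^esub> x) = a \<odot>\<^bsub>N\<^esub> f x"
      if "x \<in> carrier M" "y \<in> carrier M" for a x y
      using f that by (auto simp: rmod_hom_def)
    have "(\<lambda>x\<in>carrier M. \<ominus>\<^bsub>N\<^esub> f x) \<in> rmod_hom A M N"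
      by (rule rmod_homI)
        (use f in \<open>auto simp: * simps M.smult_closed N.minus_add N.smult_minus\<close>)
    then show "\<exists>g\<in>carrier (hom_group A M N). g \<oplus>\<^bsub>hom_group A M N\<^esub> f = \<zero>\<^bsub>hom_group A M N\<^esub>"
      using f by (intro bexI[of _ "\<lambda>x\<in>carrier M. \<ominus>\<^bsub>N\<^esub> f x"])
        (auto simp: simps N.l_neg N.r_neg intro!: restrict_ext)
  qed
qed

lemma preadditive_category_full_subcategory_proj_cat:
  assumes "S \<subseteq> Ob (proj_cat A)"
  shows "preadditive_category (full_subcategory (proj_cat A) S)"
proof -
  have mod: "right_module A M" if "M \<in> S" for M
    using assms that by (auto simp: proj_cat_def)
  have comp: "compose (carrier M) g f \<in> rmod_hom A M P"
    if "M \<in> S" "f \<in> rmod_hom A M N" "g \<in> rmod_hom A N P" for M N P f g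
  proof -
    interpret M: right_module A M using mod that(1) .
    show ?thesis
      by (rule rmod_homI) (use that(2,3) in
        \<open>auto simp: rmod_hom_def compose_def M.smult_closed PiE_def Pi_def\<close>)
  qed
  have ident: "(\<lambda>x\<in>carrier M. x) \<in> rmod_hom A M M" if "M \<in> S" for M
  proof -
    interpret M: right_module A M using mod that .
    show ?thesis by (rule rmod_homI) (auto simp: M.smult_closed)
  qed
  have add: "h \<oplus>\<^bsub>hom_group A M N\<^esub> h' \<in> rmod_hom A M N"
    if "M \<in> S" "N \<in> S" "h \<in> rmod_hom A M N" "h' \<in> rmod_hom A M N" for M N h h'
  proof -
    interpret abelian_group "hom_group A M N"
      using abelian_group_hom_group mod that by blast
    show ?thesis using a_closed[of h h'] that by (simp add: hom_group_def)
  qed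
  note defs = full_subcategory_def proj_cat_def
  have Mor: "carrier (hom_group A M N) = rmod_hom A M N" for M N by (simp add: hom_group_def)
  show ?thesis
  proof (rule preadditive_category.intro, goal_cases)
    case 1 then show ?case using abelian_group_hom_group mod by (auto simp: defs)
  next
    case 2 then show ?case using comp by (auto simp: defs Mor)
  next
    case 3 then show ?case
      by (auto simp: defs Mor compose_def rmod_hom_closed fun_eq_iff restrict_def)
  next
    case 4 then show ?case using ident by (auto simp: defs Mor)
  next
    case (5 X Y f) then show ?case
      by (auto simp: defs Mor compose_def rmod_hom_def PiE_def Pi_def extensional_def fun_eq_iff)
  next
    case (6 X Y f) then show ?case
      by (auto simp: defs Mor compose_def rmod_hom_def PiE_def Pi_def extensional_def fun_eq_iff)
  next
    case (7 X Y Z f f' g)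
    then have "g (f x \<oplus>\<^bsub>Y\<^esub> f' x) = g (f x) \<oplus>\<^bsub>Z\<^esub> g (f' x)" if "x \<in> carrier X" for x
      using that by (auto simp: defs Mor rmod_hom_def PiE_def Pi_def)
    then show ?case by (auto simp: defs compose_def hom_group_def fun_eq_iff)
  next
    case (8 X Y Z f g g') then show ?case
      by (auto simp: defs hom_group_def compose_def fun_eq_iff rmod_hom_closed)
  qed
qed

end

theory Submission
  imports Defs
begin

text \<open>
  Let \<open>R\<close> be the ring of the category and \<open>\<epsilon> = 1\<^sub>e\<close> for the object \<open>e = (A, A)\<close>. Two things connect
  \<open>R\<close> with \<open>A\<close>. Left multiplications identify \<open>A\<close> with the endomorphism ring of \<open>A\<^sub>A\<close>, which is the
  corner \<open>\<epsilon> R \<epsilon>\<close>. And by the dual basis lemma the identity of a finitely generated projective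
  module \<open>X\<close> is a finite sum \<open>\<Sum> g\<^sub>i \<circ> h\<^sub>i\<close> of maps factoring through \<open>A\<close>, so that every \<open>1\<^sub>X\<close> lies in
  \<open>R \<epsilon> R\<close>; finite sums of the \<open>1\<^sub>X\<close> are local units of \<open>R\<close>. From here on the category is forgotten:
  a ring with an idempotent \<open>\<epsilon>\<close> such that \<open>R \<epsilon> R\<close> contains local units is called a full corner
  situation, and the chain conditions are transferred between the right ideals of \<open>R\<close> contained in
  \<open>u R\<close> and the right ideals of \<open>\<epsilon> R \<epsilon> \<cong> A\<close>.

  From \<open>A\<close> to \<open>R\<close>: a right ideal \<open>J\<close> of the corner is sent to \<open>{r \<in> \<epsilon> R. r R \<epsilon> \<subseteq> J}\<close>, an order
  embedding of the right ideals of \<open>A\<close> into those of \<open>R\<close> below \<open>\<epsilon> R\<close>.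

  From \<open>R\<close> to \<open>A\<close>: write a local unit for \<open>u\<close> as \<open>e = \<Sum> p\<^sub>k \<epsilon> q\<^sub>k\<close> with \<open>n\<close> terms. The maps
  \<open>x \<mapsto> \<epsilon> q\<^sub>k x\<close> have no common kernel on \<open>u R\<close>. (Classically, they embed \<open>u R \<epsilon>\<close> into \<open>A\<^sup>n\<close>, and
  \<open>A\<^sup>n\<close> inherits the chain conditions of \<open>A\<close>.) A right ideal \<open>N\<close> below \<open>u R\<close> is filtered by the common
  kernels of the first \<open>k\<close> maps, and the \<open>k\<close>th map sends the \<open>k\<close>th layer of \<open>N \<epsilon>\<close> to a right ideal of
  \<open>A\<close>. The resulting \<open>n\<close> right ideals need not determine \<open>N\<close>, but they tell apart any two nested
  \<open>N \<subseteq> N'\<close>: an element of \<open>N'\<close> can be corrected, layer by layer, by elements of \<open>N\<close> until nothing is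
  left. So a chain becomes stationary as soon as its \<open>n\<close> image chains do.

  Gradedness costs nothing: a right ideal below \<open>1\<^sub>X R\<close> consists of matrices with a single nonzero
  row, and multiplication by \<open>1\<^sub>Y\<close> on the right cuts out the entry in column \<open>Y\<close>. Finally, the
  full corner hypotheses are left-right symmetric, so the left-hand statements are the right-hand
  ones for the opposite rings.
\<close>

section \<open>Transfer of chain conditions\<close>

text \<open>
  Finitely many monotone maps which jointly separate comparable members of \<open>\<S>\<close>. A single such map
  would be an order embedding on chains; allowing several makes the notion cover the passage to the
  subquotients of a finite filtration.
\<close>

definition chain_reduces :: "'x set set \<Rightarrow> 'y set set \<Rightarrow> bool" where
  "chain_reduces \<S> \<T> \<longleftrightarrow>
     (\<exists>(n :: nat) \<Phi>. (\<forall>k<n. \<forall>N\<in>\<S>. \<Phi> k N \<in> \<T>) \<and>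
        (\<forall>k<n. \<forall>N\<in>\<S>. \<forall>N'\<in>\<S>. N \<subseteq> N' \<longrightarrow> \<Phi> k N \<subseteq> \<Phi> k N') \<and>
        (\<forall>N\<in>\<S>. \<forall>N'\<in>\<S>. N \<subseteq> N' \<and> (\<forall>k<n. \<Phi> k N' = \<Phi> k N) \<longrightarrow> N' = N))"

lemma uniform_stabilization:
  fixes F :: "nat \<Rightarrow> nat \<Rightarrow> 'y"
  assumes "\<And>k. k < n \<Longrightarrow> \<exists>m. \<forall>i\<ge>m. F k i = F k m"
  obtains m where "\<And>k i. \<lbrakk> k < n; m \<le> i \<rbrakk> \<Longrightarrow> F k i = F k m"
proof -
  obtain f where f: "\<And>k i. \<lbrakk> k < n; f k \<le> i \<rbrakk> \<Longrightarrow> F k i = F k (f k)"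
    using assms by metis
  have "f k \<le> Max (insert 0 (f ` {..<n}))" if "k < n" for k
    using that by (intro Max_ge) auto
  then show ?thesis
    using f that[of "Max (insert 0 (f ` {..<n}))"] by (metis le_trans)
qed

lemma dcc_on_chain_reduces:
  assumes "chain_reduces \<S> \<T>" "dcc_on \<T>"
  shows "dcc_on \<S>"
  unfolding dcc_on_def
proof (intro allI impI, elim conjE)
  fix N :: "nat \<Rightarrow> 'a set"
  assume N: "range N \<subseteq> \<S>" "antimono N"
  obtain n :: nat and \<Phi> where \<Phi>: "\<forall>k<n. \<forall>N\<in>\<S>. \<Phi> k N \<in> \<T>"
    "\<forall>k<n. \<forall>N\<in>\<S>. \<forall>N'\<in>\<S>. N \<subseteq> N' \<longrightarrow> \<Phi> k N \<subseteq> \<Phi> k N'"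
    "\<forall>N\<in>\<S>. \<forall>N'\<in>\<S>. N \<subseteq> N' \<and> (\<forall>k<n. \<Phi> k N' = \<Phi> k N) \<longrightarrow> N' = N"
    using assms(1) unfolding chain_reduces_def by (elim exE conjE) (rule that, assumption+)
  have le: "N j \<subseteq> N i" if "i \<le> j" for i j using N(2) that by (auto simp: antimono_def)
  have "\<exists>m. \<forall>i\<ge>m. \<Phi> k (N i) = \<Phi> k (N m)" if "k < n" for k
  proof -
    have "range (\<lambda>i. \<Phi> k (N i)) \<subseteq> \<T>" "antimono (\<lambda>i. \<Phi> k (N i))"
      using N(1) \<Phi>(1,2) le that by (auto simp: antimono_def image_subset_iff)
    then show ?thesis using assms(2) unfolding dcc_on_def by blast
  qed
  then obtain m where m: "\<And>k i. \<lbrakk> k < n; m \<le> i \<rbrakk> \<Longrightarrow> \<Phi> k (N i) = \<Phi> k (N m)"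
    using uniform_stabilization[of n "\<lambda>k i. \<Phi> k (N i)"] by metis
  have "N i = N m" if "m \<le> i" for i
    using \<Phi>(3)[rule_format, of "N i" "N m"] N(1) le[OF that] m[OF _ that] by auto
  then show "\<exists>m. \<forall>i\<ge>m. N i = N m" by blast
qed

lemma acc_on_chain_reduces:
  assumes "chain_reduces \<S> \<T>" "acc_on \<T>"
  shows "acc_on \<S>"
  unfolding acc_on_def
proof (intro allI impI, elim conjE)
  fix N :: "nat \<Rightarrow> 'a set"
  assume N: "range N \<subseteq> \<S>" "mono N"
  obtain n :: nat and \<Phi> where \<Phi>: "\<forall>k<n. \<forall>N\<in>\<S>. \<Phi> k N \<in> \<T>"
    "\<forall>k<n. \<forall>N\<in>\<S>. \<forall>N'\<in>\<S>. N \<subseteq> N' \<longrightarrow> \<Phi> k N \<subseteq> \<Phi> k N'"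
    "\<forall>N\<in>\<S>. \<forall>N'\<in>\<S>. N \<subseteq> N' \<and> (\<forall>k<n. \<Phi> k N' = \<Phi> k N) \<longrightarrow> N' = N"
    using assms(1) unfolding chain_reduces_def by (elim exE conjE) (rule that, assumption+)
  have le: "N i \<subseteq> N j" if "i \<le> j" for i j using N(2) that by (auto simp: mono_def)
  have "\<exists>m. \<forall>i\<ge>m. \<Phi> k (N i) = \<Phi> k (N m)" if "k < n" for k
  proof -
    have "range (\<lambda>i. \<Phi> k (N i)) \<subseteq> \<T>" "mono (\<lambda>i. \<Phi> k (N i))"
      using N(1) \<Phi>(1,2) le that by (auto simp: mono_def image_subset_iff)
    then show ?thesis using assms(2) unfolding acc_on_def by blast
  qed
  then obtain m where m: "\<And>k i. \<lbrakk> k < n; m \<le> i \<rbrakk> \<Longrightarrow> \<Phi> k (N i) = \<Phi> k (N m)"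
    using uniform_stabilization[of n "\<lambda>k i. \<Phi> k (N i)"] by metis
  have "N i = N m" if "m \<le> i" for i
    using \<Phi>(3)[rule_format, of "N m" "N i"] N(1) le[OF that] m[OF _ that] by auto
  then show "\<exists>m. \<forall>i\<ge>m. N i = N m" by blast
qed


section \<open>Rings without identity and their one-sided ideals\<close>

text \<open>
  The ring of a category with infinitely many nonzero objects has no identity element; it only has
  local units.
\<close>

locale rng = abelian_group R for R (structure) +
  assumes m_closed: "\<lbrakk> x \<in> carrier R; y \<in> carrier R \<rbrakk> \<Longrightarrow> x \<otimes> y \<in> carrier R"
    and m_assoc: "\<lbrakk> x \<in> carrier R; y \<in> carrier R; z \<in> carrier R \<rbrakk> \<Longrightarrow>
      (x \<otimes> y) \<otimes> z = x \<otimes> (y \<otimes> z)"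
    and l_distr: "\<lbrakk> x \<in> carrier R; y \<in> carrier R; z \<in> carrier R \<rbrakk> \<Longrightarrow>
      (x \<oplus> y) \<otimes> z = x \<otimes> z \<oplus> y \<otimes> z"
    and r_distr: "\<lbrakk> x \<in> carrier R; y \<in> carrier R; z \<in> carrier R \<rbrakk> \<Longrightarrow>
      z \<otimes> (x \<oplus> y) = z \<otimes> x \<oplus> z \<otimes> y"
begin

lemma m_zero_right: "x \<in> carrier R \<Longrightarrow> x \<otimes> \<zero> = \<zero>"
  using r_distr[of \<zero> \<zero> x, symmetric] m_closed[of x \<zero>] add.r_cancel_one by simp

lemma m_zero_left: "x \<in> carrier R \<Longrightarrow> \<zero> \<otimes> x = \<zero>"
  using l_distr[of \<zero> \<zero> x, symmetric] m_closed[of \<zero> x] add.r_cancel_one by simp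

lemma minus_unique:
  assumes "x \<in> carrier R" "y \<in> carrier R" "z \<in> carrier R" "z \<oplus> y = x"
  shows "z = x \<ominus> y"
  using assms by (auto simp: a_minus_def a_assoc r_neg)

lemma minus_cancel: "\<lbrakk> x \<in> carrier R; y \<in> carrier R \<rbrakk> \<Longrightarrow> (x \<ominus> y) \<oplus> y = x"
  by (simp add: a_minus_def a_assoc l_neg)

lemma minus_self: "x \<in> carrier R \<Longrightarrow> x \<ominus> x = \<zero>"
  by (simp add: a_minus_def r_neg)

lemma r_distr_minus:
  assumes "x \<in> carrier R" "y \<in> carrier R" "z \<in> carrier R"
  shows "z \<otimes> (x \<ominus> y) = z \<otimes> x \<ominus> z \<otimes> y"
  using assms r_distr[of "x \<ominus> y" y z]
  by (intro minus_unique) (auto simp: minus_cancel m_closed)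

lemma l_distr_minus:
  assumes "x \<in> carrier R" "y \<in> carrier R" "z \<in> carrier R"
  shows "(x \<ominus> y) \<otimes> z = x \<otimes> z \<ominus> y \<otimes> z"
  using assms l_distr[of "x \<ominus> y" y z]
  by (intro minus_unique) (auto simp: minus_cancel m_closed)

end

lemma (in ring) rng: "rng R"
  by unfold_locales (auto simp: m_assoc l_distr r_distr)

definition opposite_ring :: "('a, 'z) ring_scheme \<Rightarrow> ('a, 'z) ring_scheme" where
  "opposite_ring R = R\<lparr>monoid.mult := \<lambda>x y. y \<otimes>\<^bsub>R\<^esub> x\<rparr>"

lemma opposite_ring_simps [simp]:
  "carrier (opposite_ring R) = carrier R"
  "x \<otimes>\<^bsub>opposite_ring R\<^esub> y = y \<otimes>\<^bsub>R\<^esub> x"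
  "\<one>\<^bsub>opposite_ring R\<^esub> = \<one>\<^bsub>R\<^esub>"
  "\<zero>\<^bsub>opposite_ring R\<^esub> = \<zero>\<^bsub>R\<^esub>"
  "x \<oplus>\<^bsub>opposite_ring R\<^esub> y = x \<oplus>\<^bsub>R\<^esub> y"
  "x \<ominus>\<^bsub>opposite_ring R\<^esub> y = x \<ominus>\<^bsub>R\<^esub> y"
  by (simp_all add: opposite_ring_def a_minus_def a_inv_def)

lemma abelian_group_opposite_ring: "abelian_group R \<Longrightarrow> abelian_group (opposite_ring R)"
  by (simp add: abelian_group_def abelian_monoid_def abelian_group_axioms_def opposite_ring_def)

lemma rng_opposite_ring:
  assumes "rng R" shows "rng (opposite_ring R)"
proof -
  interpret rng R by fact
  interpret op: abelian_group "opposite_ring R"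
    using abelian_group_opposite_ring abelian_group_axioms .
  show ?thesis by unfold_locales (auto simp: m_assoc l_distr r_distr m_closed)
qed

lemma ring_opposite_ring:
  assumes "ring R" shows "ring (opposite_ring R)"
proof -
  interpret ring R by fact
  interpret op: abelian_group "opposite_ring R"
    using abelian_group_opposite_ring abelian_group_axioms .
  show ?thesis by (rule ringI) (unfold_locales, auto simp: m_assoc l_distr r_distr)
qed

text \<open>
  Closure under differences is one condition in place of two, and it refers to the additive group
  of the whole ring only.
\<close>

definition right_ideal :: "('a, 'z) ring_scheme \<Rightarrow> 'a set \<Rightarrow> bool" where
  "right_ideal R N \<longleftrightarrow> N \<subseteq> carrier R \<and> \<zero>\<^bsub>R\<^esub> \<in> N \<and>
     (\<forall>x\<in>N. \<forall>y\<in>N. x \<ominus>\<^bsub>R\<^esub> y \<in> N) \<and> (\<forall>x\<in>N. \<forall>r\<in>carrier R. x \<otimes>\<^bsub>R\<^esub> r \<in> N)"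

lemma right_idealD:
  assumes "right_ideal R N"
  shows "x \<in> N \<Longrightarrow> x \<in> carrier R" "\<zero>\<^bsub>R\<^esub> \<in> N"
    "\<lbrakk> x \<in> N; y \<in> N \<rbrakk> \<Longrightarrow> x \<ominus>\<^bsub>R\<^esub> y \<in> N" "\<lbrakk> x \<in> N; r \<in> carrier R \<rbrakk> \<Longrightarrow> x \<otimes>\<^bsub>R\<^esub> r \<in> N"
  using assms by (auto simp: right_ideal_def)

lemma (in rng) right_ideal_add:
  assumes N: "right_ideal R N" and xy: "x \<in> N" "y \<in> N"
  shows "x \<oplus> y \<in> N"
proof -
  note D = right_idealD[OF N]
  have "x \<ominus> (\<zero> \<ominus> y) \<in> N" by (intro D(3)) (use D(2) xy in auto)
  moreover have "x \<ominus> (\<zero> \<ominus> y) = x \<oplus> y" using D(1) xy by (simp add: a_minus_def)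
  ultimately show ?thesis by simp
qed

lemma (in abelian_group) subgroup_iff_diff_closed:
  "subgroup N (add_monoid G) \<longleftrightarrow> N \<subseteq> carrier G \<and> \<zero> \<in> N \<and> (\<forall>x\<in>N. \<forall>y\<in>N. x \<ominus> y \<in> N)"
proof
  assume "subgroup N (add_monoid G)"
  then interpret subgroup N "add_monoid G" .
  show "N \<subseteq> carrier G \<and> \<zero> \<in> N \<and> (\<forall>x\<in>N. \<forall>y\<in>N. x \<ominus> y \<in> N)"
    using subset one_closed m_closed m_inv_closed by (auto simp: a_minus_def a_inv_def)
next
  assume N: "N \<subseteq> carrier G \<and> \<zero> \<in> N \<and> (\<forall>x\<in>N. \<forall>y\<in>N. x \<ominus> y \<in> N)"
  have inv: "\<ominus> x \<in> N" if "x \<in> N" for x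
  proof -
    have "\<zero> \<ominus> x \<in> N" "x \<in> carrier G" using N that by auto
    then show ?thesis by (simp add: a_minus_def)
  qed
  have add: "x \<oplus> y \<in> N" if "x \<in> N" "y \<in> N" for x y
  proof -
    have "x \<ominus> (\<ominus> y) \<in> N" "x \<in> carrier G" "y \<in> carrier G" using N that inv by auto
    then show ?thesis by (simp add: a_minus_def)
  qed
  show "subgroup N (add_monoid G)"
    using N inv add by (intro subgroup.intro) (auto simp: a_inv_def[symmetric])
qed

text \<open>The inverse in a subgroup is the ambient one, so subgroups of a subgroup are recognised by
  differences formed in the ambient group.\<close>

lemma (in abelian_group) subgroup_restrict_iff:
  fixes M :: "('a, 'z) ring_scheme"
  assumes K: "carrier M \<subseteq> carrier G" "\<zero> \<in> carrier M"
      "\<And>x y. \<lbrakk> x \<in> carrier M; y \<in> carrier M \<rbrakk> \<Longrightarrow> x \<ominus> y \<in> carrier M"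
    and M: "ring.add M = ring.add G" "ring.zero M = ring.zero G"
  shows "subgroup N (add_monoid M) \<longleftrightarrow>
    N \<subseteq> carrier M \<and> \<zero> \<in> N \<and> (\<forall>x\<in>N. \<forall>y\<in>N. x \<ominus> y \<in> N)"
proof -
  have KG: "x \<in> carrier G" if "x \<in> carrier M" for x using K that by auto
  have inv: "\<ominus> x \<in> carrier M" if "x \<in> carrier M" for x
    using K(3)[OF K(2) that] KG[OF that] by (simp add: a_minus_def)
  have add: "x \<oplus> y \<in> carrier M" if "x \<in> carrier M" "y \<in> carrier M" for x y
    using K(3)[OF that(1) inv[OF that(2)]] KG that by (simp add: a_minus_def)
  interpret M: abelian_group M
  proof (rule abelian_groupI)
    show "\<exists>y\<in>carrier M. y \<oplus>\<^bsub>M\<^esub> x = \<zero>\<^bsub>M\<^esub>" if "x \<in> carrier M" for x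
      using that inv KG by (intro bexI[of _ "\<ominus> x"]) (auto simp: M l_neg)
  qed (use K(2) add KG in \<open>auto simp: M a_ac\<close>)
  have "\<ominus>\<^bsub>M\<^esub> y = \<ominus> y" if "y \<in> carrier M" for y
    by (rule M.minus_equality) (use inv KG that in \<open>auto simp: M l_neg\<close>)
  then have "x \<ominus>\<^bsub>M\<^esub> y = x \<ominus> y" if "y \<in> carrier M" for x y
    using that by (simp add: a_minus_def M)
  then have "(\<forall>x\<in>N. \<forall>y\<in>N. x \<ominus>\<^bsub>M\<^esub> y \<in> N) \<longleftrightarrow> (\<forall>x\<in>N. \<forall>y\<in>N. x \<ominus> y \<in> N)"
    if "N \<subseteq> carrier M"
    using that by (simp add: subset_iff)
  then show ?thesis unfolding M.subgroup_iff_diff_closed unfolding M(2) by blast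
qed

lemma submodule_right_regular_iff:
  assumes "abelian_group R"
  shows "submodule N R (right_regular R) \<longleftrightarrow> right_ideal R N"
proof -
  interpret abelian_group R by fact
  have "subgroup N (add_monoid (right_regular R)) \<longleftrightarrow>
      N \<subseteq> carrier R \<and> \<zero>\<^bsub>R\<^esub> \<in> N \<and> (\<forall>x\<in>N. \<forall>y\<in>N. x \<ominus>\<^bsub>R\<^esub> y \<in> N)"
    by (subst subgroup_restrict_iff) (auto simp: right_regular_def)
  then show ?thesis
    unfolding submodule_def submodule_axioms_def right_ideal_def by (auto simp: right_regular_def)
qed

text \<open>
  All one-sided notions on the left are treated as right-hand notions over the opposite ring.
\<close>

lemma submodule_left_regular_iff:
  assumes "abelian_group R"
  shows "submodule N R (left_regular R) \<longleftrightarrow> right_ideal (opposite_ring R) N"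
proof -
  have "submodule N R (left_regular R) \<longleftrightarrow>
      submodule N (opposite_ring R) (right_regular (opposite_ring R))"
    by (simp add: submodule_def submodule_axioms_def left_regular_def right_regular_def opposite_ring_def)
  then show ?thesis using submodule_right_regular_iff abelian_group_opposite_ring assms by blast
qed


section \<open>Full corners\<close>

text \<open>
  The two-sided ideal \<open>R \<epsilon> R\<close>, built as lists of summands \<open>p \<epsilon> q\<close>; facts about a finite
  decomposition \<open>e = \<Sum> p\<^sub>k \<epsilon> q\<^sub>k\<close> then follow by induction without indexing the sum.
\<close>

inductive_set span_through :: "('r, 'z) ring_scheme \<Rightarrow> 'r \<Rightarrow> 'r set"
  for R :: "('r, 'z) ring_scheme" and \<epsilon> :: 'r where
  zero: "\<zero>\<^bsub>R\<^esub> \<in> span_through R \<epsilon>"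
| add: "\<lbrakk> p \<in> carrier R; q \<in> carrier R; s \<in> span_through R \<epsilon> \<rbrakk> \<Longrightarrow>
    (p \<otimes>\<^bsub>R\<^esub> (\<epsilon> \<otimes>\<^bsub>R\<^esub> q)) \<oplus>\<^bsub>R\<^esub> s \<in> span_through R \<epsilon>"

lemma (in rng) span_through_closed:
  assumes "\<epsilon> \<in> carrier R" "s \<in> span_through R \<epsilon>" shows "s \<in> carrier R"
  using assms(2,1) by induction (auto simp: m_closed)

lemma (in rng) span_through_add:
  assumes "\<epsilon> \<in> carrier R" "s \<in> span_through R \<epsilon>" "t \<in> span_through R \<epsilon>"
  shows "s \<oplus> t \<in> span_through R \<epsilon>"
  using assms(2)
proof induction
  case zero
  then show ?case using assms span_through_closed by simp
next
  case (add p q s)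
  have "(p \<otimes> (\<epsilon> \<otimes> q) \<oplus> s) \<oplus> t = p \<otimes> (\<epsilon> \<otimes> q) \<oplus> (s \<oplus> t)"
    using add assms span_through_closed by (intro a_assoc) (auto simp: m_closed)
  then show ?case using add span_through.add[of p R q "s \<oplus> t"] by simp
qed

lemma (in rng) span_through_opposite:
  assumes "\<epsilon> \<in> carrier R" "s \<in> span_through R \<epsilon>"
  shows "s \<in> span_through (opposite_ring R) \<epsilon>"
  using assms(2)
proof induction
  case zero
  then show ?case using span_through.zero[of "opposite_ring R"] by simp
next
  case (add p q s)
  then show ?case using assms(1) span_through.add[of q "opposite_ring R" p s \<epsilon>]
    by (simp add: m_assoc)
qed

text \<open>
  If \<open>s = \<Sum> p\<^sub>k \<epsilon> q\<^sub>k\<close>, then \<open>s x = \<Sum> p\<^sub>k (\<epsilon> q\<^sub>k x)\<close>: the finitely many coordinates \<open>\<epsilon> q\<^sub>k x\<close> control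
  \<open>s x\<close>.
\<close>

lemma (in rng) span_through_joint_kernel:
  assumes "\<epsilon> \<in> carrier R" "s \<in> span_through R \<epsilon>"
  obtains Q where "set Q \<subseteq> carrier R"
    "\<And>x. \<lbrakk> x \<in> carrier R; \<And>q. q \<in> set Q \<Longrightarrow> \<epsilon> \<otimes> (q \<otimes> x) = \<zero> \<rbrakk> \<Longrightarrow> s \<otimes> x = \<zero>"
  using assms(2)
proof (induction arbitrary: thesis)
  case zero
  show ?case by (rule zero[of "[]"]) (auto simp: m_zero_left)
next
  case (add p q s)
  obtain Q where Q: "set Q \<subseteq> carrier R"
    "\<And>x. \<lbrakk> x \<in> carrier R; \<And>q. q \<in> set Q \<Longrightarrow> \<epsilon> \<otimes> (q \<otimes> x) = \<zero> \<rbrakk> \<Longrightarrow> s \<otimes> x = \<zero>"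
    using add.IH by blast
  show ?case
  proof (rule add.prems[of "q # Q"])
    fix x assume x: "x \<in> carrier R" "\<And>q'. q' \<in> set (q # Q) \<Longrightarrow> \<epsilon> \<otimes> (q' \<otimes> x) = \<zero>"
    have "(p \<otimes> (\<epsilon> \<otimes> q) \<oplus> s) \<otimes> x = p \<otimes> (\<epsilon> \<otimes> (q \<otimes> x)) \<oplus> s \<otimes> x"
      using x(1) add.hyps assms(1) span_through_closed by (simp add: l_distr m_assoc m_closed)
    also have "\<dots> = \<zero>" using Q(2)[of x] x add.hyps by (simp add: m_zero_right)
    finally show "(p \<otimes> (\<epsilon> \<otimes> q) \<oplus> s) \<otimes> x = \<zero>" .
  qed (use Q add.hyps in auto)
qed

text \<open>
  The counterpart on the other side: \<open>r s = \<Sum> (r p\<^sub>k \<epsilon>) q\<^sub>k\<close> lies in every right ideal that contains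
  the elements \<open>r p\<^sub>k \<epsilon>\<close>.
\<close>

lemma (in rng) span_through_right_mult:
  assumes "\<epsilon> \<in> carrier R" "s \<in> span_through R \<epsilon>" "right_ideal R N" "r \<in> carrier R"
    and "\<And>p. p \<in> carrier R \<Longrightarrow> r \<otimes> (p \<otimes> \<epsilon>) \<in> N"
  shows "r \<otimes> s \<in> N"
  using assms(2)
proof induction
  case zero
  then show ?case using assms right_idealD by (fastforce simp: m_zero_right)
next
  case (add p q s)
  have "r \<otimes> (p \<otimes> (\<epsilon> \<otimes> q) \<oplus> s) = (r \<otimes> (p \<otimes> \<epsilon>)) \<otimes> q \<oplus> r \<otimes> s"
    using add.hyps assms span_through_closed by (simp add: r_distr m_assoc m_closed)
  then show ?case
    using right_ideal_add[OF assms(3)] right_idealD(4)[OF assms(3)] add assms(5) by metis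
qed

text \<open>
  The map \<open>\<theta>\<close> identifies the unital ring \<open>A\<close> with the corner \<open>\<epsilon> R \<epsilon>\<close>, where \<open>\<epsilon> = \<theta> 1\<close>. The last
  condition is the substitute for \<open>R \<epsilon> R = R\<close> in a ring without identity. Asking for a two-sided
  local unit keeps the hypotheses invariant under passing to opposite rings.
\<close>

locale full_corner = rng R + A: ring A
  for R :: "('r, 'y) ring_scheme" (structure) and A :: "('a, 'z) ring_scheme" and \<theta> :: "'a \<Rightarrow> 'r" +
  assumes emb_closed: "a \<in> carrier A \<Longrightarrow> \<theta> a \<in> carrier R"
    and emb_add: "\<lbrakk> a \<in> carrier A; b \<in> carrier A \<rbrakk> \<Longrightarrow> \<theta> (a \<oplus>\<^bsub>A\<^esub> b) = \<theta> a \<oplus> \<theta> b"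
    and emb_mult: "\<lbrakk> a \<in> carrier A; b \<in> carrier A \<rbrakk> \<Longrightarrow> \<theta> (a \<otimes>\<^bsub>A\<^esub> b) = \<theta> a \<otimes> \<theta> b"
    and emb_inj: "inj_on \<theta> (carrier A)"
    and emb_onto: "r \<in> carrier R \<Longrightarrow> \<exists>a\<in>carrier A. \<theta> a = \<theta> \<one>\<^bsub>A\<^esub> \<otimes> (r \<otimes> \<theta> \<one>\<^bsub>A\<^esub>)"
    and local_unit: "r \<in> carrier R \<Longrightarrow> \<exists>e\<in>span_through R (\<theta> \<one>\<^bsub>A\<^esub>). e \<otimes> r = r \<and> r \<otimes> e = r"
begin

abbreviation corner_unit ("\<epsilon>") where "\<epsilon> \<equiv> \<theta> \<one>\<^bsub>A\<^esub>"

lemma corner_unit_closed [simp]: "\<epsilon> \<in> carrier R"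
  by (simp add: emb_closed)

lemma emb_unit:
  assumes "a \<in> carrier A" shows "\<epsilon> \<otimes> \<theta> a = \<theta> a" "\<theta> a \<otimes> \<epsilon> = \<theta> a"
  using assms by (simp_all flip: emb_mult)

lemma emb_minus:
  assumes "a \<in> carrier A" "b \<in> carrier A" shows "\<theta> (a \<ominus>\<^bsub>A\<^esub> b) = \<theta> a \<ominus> \<theta> b"
proof -
  interpret A': rng A by (rule A.rng)
  have "\<theta> (a \<ominus>\<^bsub>A\<^esub> b) \<oplus> \<theta> b = \<theta> a"
    using assms emb_add[of "a \<ominus>\<^bsub>A\<^esub> b" b] A'.minus_cancel[OF assms] by simp
  then show ?thesis using assms by (intro minus_unique) (auto simp: emb_closed)
qed

lemma emb_zero: "\<theta> \<zero>\<^bsub>A\<^esub> = \<zero>"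
proof -
  have "\<theta> \<zero>\<^bsub>A\<^esub> \<oplus> \<theta> \<zero>\<^bsub>A\<^esub> = \<theta> \<zero>\<^bsub>A\<^esub>"
    by (subst emb_add[symmetric]) auto
  then show ?thesis using emb_closed[of "\<zero>\<^bsub>A\<^esub>"] add.r_cancel_one by simp
qed

lemma full_corner_opposite: "full_corner (opposite_ring R) (opposite_ring A) \<theta>"
proof -
  interpret opR: rng "opposite_ring R" using rng_opposite_ring rng_axioms .
  interpret opA: ring "opposite_ring A" using ring_opposite_ring A.ring_axioms .
  show ?thesis
  proof unfold_locales
    fix r assume r: "r \<in> carrier (opposite_ring R)"
    then show "\<exists>a\<in>carrier (opposite_ring A). \<theta> a =
      \<theta> \<one>\<^bsub>opposite_ring A\<^esub> \<otimes>\<^bsub>opposite_ring R\<^esub> (r \<otimes>\<^bsub>opposite_ring R\<^esub> \<theta> \<one>\<^bsub>opposite_ring A\<^esub>)"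
      using emb_onto by (simp add: m_assoc)
    show "\<exists>e\<in>span_through (opposite_ring R) (\<theta> \<one>\<^bsub>opposite_ring A\<^esub>).
        e \<otimes>\<^bsub>opposite_ring R\<^esub> r = r \<and> r \<otimes>\<^bsub>opposite_ring R\<^esub> e = r"
      using local_unit[of r] span_through_opposite[OF corner_unit_closed] r by auto
  qed (auto simp: emb_closed emb_add emb_mult emb_inj)
qed

text \<open>
  With \<open>e = \<Sum> p\<^sub>k \<epsilon> q\<^sub>k\<close> a local unit for \<open>u\<close>, the coordinates \<open>\<epsilon> q\<^sub>k x\<close> vanish simultaneously only at
  \<open>x = 0\<close> among all \<open>x \<in> u R\<close>. The \<open>k\<close>th right ideal of \<open>A\<close> attached to \<open>N\<close> collects the \<open>k\<close>th
  coordinates of those elements of \<open>N \<epsilon>\<close> whose previous coordinates vanish.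
\<close>

lemma chain_reduces_right_ideals_to_corner:
  assumes u: "u \<in> carrier R"
  shows "chain_reduces {N. right_ideal R N \<and> (\<forall>x\<in>N. u \<otimes> x = x)} {J. right_ideal A J}"
proof -
  obtain e where e: "e \<in> span_through R \<epsilon>" "e \<otimes> u = u" using local_unit u by blast
  then have eR: "e \<in> carrier R" using span_through_closed[OF corner_unit_closed] by simp
  obtain Q where Q: "set Q \<subseteq> carrier R"
    "\<And>x. \<lbrakk> x \<in> carrier R; \<And>q. q \<in> set Q \<Longrightarrow> \<epsilon> \<otimes> (q \<otimes> x) = \<zero> \<rbrakk> \<Longrightarrow> e \<otimes> x = \<zero>"
    using span_through_joint_kernel[OF corner_unit_closed e(1)] by blast
  have Qc: "Q ! k \<in> carrier R" if "k < length Q" for k using Q(1) that by auto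
  define n where "n = length Q"
  define layer where "layer k N = {x\<in>N. x \<otimes> \<epsilon> = x \<and> (\<forall>j<k. \<epsilon> \<otimes> (Q ! j \<otimes> x) = \<zero>)}" for k N
  define \<Phi> where "\<Phi> k N = {a\<in>carrier A. \<exists>x\<in>layer k N. \<theta> a = \<epsilon> \<otimes> (Q ! k \<otimes> x)}" for k N
  have ideal: "right_ideal A (\<Phi> k N)" if k: "k < n" and N: "right_ideal R N" for k N
  proof -
    note D = right_idealD[OF N]
    have kQ: "Q ! j \<in> carrier R" if "j \<le> k" for j using Qc k that by (simp add: n_def)
    have 0: "\<zero>\<^bsub>A\<^esub> \<in> \<Phi> k N"
    proof -
      have "\<zero> \<in> layer k N" using D(2) kQ by (simp add: layer_def m_zero_left m_zero_right)
      moreover have "\<theta> \<zero>\<^bsub>A\<^esub> = \<epsilon> \<otimes> (Q ! k \<otimes> \<zero>)" using kQ by (simp add: emb_zero m_zero_right)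
      ultimately show ?thesis unfolding \<Phi>_def by blast
    qed
    have 1: "a \<ominus>\<^bsub>A\<^esub> b \<in> \<Phi> k N" if ab: "a \<in> \<Phi> k N" "b \<in> \<Phi> k N" for a b
    proof -
      obtain x y where xy: "x \<in> layer k N" "\<theta> a = \<epsilon> \<otimes> (Q ! k \<otimes> x)" "a \<in> carrier A"
        "y \<in> layer k N" "\<theta> b = \<epsilon> \<otimes> (Q ! k \<otimes> y)" "b \<in> carrier A"
        using ab unfolding \<Phi>_def by blast
      then have R: "x \<in> carrier R" "y \<in> carrier R" using D(1) by (auto simp: layer_def)
      have "x \<ominus> y \<in> layer k N"
        using xy R D(3) kQ minus_self
        by (simp add: layer_def l_distr_minus r_distr_minus m_closed)
      moreover have "\<theta> (a \<ominus>\<^bsub>A\<^esub> b) = \<epsilon> \<otimes> (Q ! k \<otimes> (x \<ominus> y))"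
        using xy R kQ by (simp add: emb_minus r_distr_minus m_closed)
      ultimately show ?thesis using xy unfolding \<Phi>_def by blast
    qed
    have 2: "a \<otimes>\<^bsub>A\<^esub> b \<in> \<Phi> k N" if ab: "a \<in> \<Phi> k N" "b \<in> carrier A" for a b
    proof -
      obtain x where x: "x \<in> layer k N" "\<theta> a = \<epsilon> \<otimes> (Q ! k \<otimes> x)" "a \<in> carrier A"
        using ab unfolding \<Phi>_def by blast
      have shift: "\<epsilon> \<otimes> (Q ! j \<otimes> (x \<otimes> \<theta> b)) = (\<epsilon> \<otimes> (Q ! j \<otimes> x)) \<otimes> \<theta> b" if "j \<le> k" for j
        using x kQ[OF that] D(1) ab by (simp add: layer_def m_assoc m_closed emb_closed)
      have "x \<otimes> \<theta> b \<in> layer k N"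
        using x D(1,4) ab by (auto simp: shift layer_def emb_closed m_assoc emb_unit m_zero_left)
      moreover have "\<theta> (a \<otimes>\<^bsub>A\<^esub> b) = \<epsilon> \<otimes> (Q ! k \<otimes> (x \<otimes> \<theta> b))"
        using x ab by (simp add: shift emb_mult)
      ultimately show ?thesis using x ab unfolding \<Phi>_def by blast
    qed
    show ?thesis unfolding right_ideal_def using 0 1 2 by (auto simp: \<Phi>_def)
  qed
  have mono: "\<Phi> k N \<subseteq> \<Phi> k N'" if "N \<subseteq> N'" for k N N'
    using that by (auto simp: \<Phi>_def layer_def)
  have inj: "N' = N"
    if N: "right_ideal R N" "right_ideal R N'" "\<And>x. x \<in> N' \<Longrightarrow> u \<otimes> x = x"
      and sub: "N \<subseteq> N'" and eq: "\<And>k. k < n \<Longrightarrow> \<Phi> k N' = \<Phi> k N" for N N'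
  proof -
    note D = right_idealD[OF N(1)] and D' = right_idealD[OF N(2)]
    \<comment> \<open>successive approximation of an element of \<open>N' \<epsilon>\<close> by elements of \<open>N \<epsilon>\<close>, one coordinate at a time\<close>
    have approx: "\<exists>y\<in>N. x \<ominus> y \<in> layer k N'"
      if x: "x \<in> N'" "x \<otimes> \<epsilon> = x" and "k \<le> n" for x k
      using that(3)
    proof (induction k)
      case 0
      have "x \<ominus> \<zero> = x" using x D'(1) by (simp add: a_minus_def)
      then show ?case using x D(2) by (intro bexI[of _ \<zero>]) (auto simp: layer_def)
    next
      case (Suc k)
      then obtain y where y: "y \<in> N" "x \<ominus> y \<in> layer k N'" by auto
      define d where "d = x \<ominus> y"
      have d: "d \<in> N'" "d \<in> carrier R" "d \<otimes> \<epsilon> = d" "d \<in> layer k N'"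
        using y D' by (auto simp: layer_def d_def)
      have kQ: "Q ! j \<in> carrier R" if "j \<le> k" for j using Qc Suc.prems that by (simp add: n_def)
      obtain a where a: "a \<in> carrier A" "\<theta> a = \<epsilon> \<otimes> (Q ! k \<otimes> d)"
        using emb_onto[of "Q ! k \<otimes> d"] kQ[of k] d by (auto simp: m_closed m_assoc)
      then have "a \<in> \<Phi> k N'" using d(4) unfolding \<Phi>_def by blast
      then have "a \<in> \<Phi> k N" using eq[of k] Suc.prems by simp
      then obtain z where z: "z \<in> layer k N" "\<theta> a = \<epsilon> \<otimes> (Q ! k \<otimes> z)" by (auto simp: \<Phi>_def)
      then have z': "z \<in> N" "z \<in> carrier R" "z \<in> N'" using D sub by (auto simp: layer_def)
      have "d \<ominus> z \<in> layer (Suc k) N'"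
        using d z z' kQ a D'(3)
        by (auto simp: layer_def l_distr_minus r_distr_minus m_closed less_Suc_eq minus_self)
      moreover have "d \<ominus> z = x \<ominus> (y \<oplus> z)"
        using y z' x D D' by (simp add: d_def a_minus_def minus_add a_assoc)
      ultimately show ?case using right_ideal_add[OF N(1) y(1) z'(1)] by auto
    qed
    \<comment> \<open>once all coordinates of the difference are zero, \<open>e\<close> kills it, but \<open>e\<close> also fixes \<open>u R\<close>\<close>
    have corner: "x \<in> N" if x: "x \<in> N'" "x \<otimes> \<epsilon> = x" for x
    proof -
      obtain y where y: "y \<in> N" "x \<ominus> y \<in> layer n N'" using approx[OF x order_refl] by blast
      then have d: "x \<ominus> y \<in> N'" "x \<ominus> y \<in> carrier R" using D' by (auto simp: layer_def)
      have "e \<otimes> (x \<ominus> y) = \<zero>"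
        using Q(2)[OF d(2)] y(2) by (auto simp: layer_def n_def in_set_conv_nth)
      moreover have "e \<otimes> (x \<ominus> y) = x \<ominus> y"
        using m_assoc[OF eR u d(2)] N(3)[OF d(1)] e(2) by simp
      ultimately have "x \<ominus> y = \<zero>" by simp
      then have "x = y" using x y D D' minus_cancel[of x y] by auto
      then show ?thesis using y by simp
    qed
    \<comment> \<open>an arbitrary \<open>x \<in> N'\<close> is recovered from the elements \<open>x p \<epsilon> \<in> N' \<epsilon>\<close> through a right local unit\<close>
    have "x \<in> N" if x: "x \<in> N'" for x
    proof -
      have xR: "x \<in> carrier R" using D' x by simp
      then obtain f where f: "f \<in> span_through R \<epsilon>" "x \<otimes> f = x" using local_unit by blast
      have "x \<otimes> (p \<otimes> \<epsilon>) \<in> N" if p: "p \<in> carrier R" for p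
        using p x xR D'(4)[OF x] emb_unit[of "\<one>\<^bsub>A\<^esub>"]
        by (intro corner) (auto simp: m_assoc m_closed)
      then have "x \<otimes> f \<in> N"
        using span_through_right_mult[OF corner_unit_closed f(1) N(1) xR] by blast
      then show ?thesis using f(2) by simp
    qed
    then show ?thesis using sub by blast
  qed
  show ?thesis
    unfolding chain_reduces_def
    using ideal mono inj by (intro exI[of _ n] exI[of _ \<Phi>]) auto
qed

text \<open>
  The right ideal \<open>{r \<in> \<epsilon> R. r R \<epsilon> \<subseteq> \<theta> J}\<close> is the largest one below \<open>\<epsilon> R\<close> whose intersection with
  the corner is \<open>\<theta> J\<close>; in particular it determines \<open>J\<close>.
\<close>

lemma chain_reduces_corner_to_right_ideals:
  "chain_reduces {J. right_ideal A J} {N. right_ideal R N \<and> (\<forall>x\<in>N. \<epsilon> \<otimes> x = x)}"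
proof -
  define \<Psi> where "\<Psi> J = {r\<in>carrier R. \<epsilon> \<otimes> r = r \<and>
    (\<forall>p\<in>carrier R. \<exists>a\<in>J. r \<otimes> (p \<otimes> \<epsilon>) = \<theta> a)}" for J
  have ideal: "right_ideal R (\<Psi> J)" if J: "right_ideal A J" for J
  proof -
    note D = right_idealD[OF J]
    have 0: "\<zero> \<in> \<Psi> J"
      using D(2) by (auto simp: \<Psi>_def m_zero_left m_zero_right m_closed emb_zero
          intro!: bexI[of _ "\<zero>\<^bsub>A\<^esub>"])
    have 1: "x \<ominus> y \<in> \<Psi> J" if xy: "x \<in> \<Psi> J" "y \<in> \<Psi> J" for x y
    proof -
      have "\<exists>c\<in>J. (x \<ominus> y) \<otimes> (p \<otimes> \<epsilon>) = \<theta> c" if p: "p \<in> carrier R" for p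
      proof -
        obtain a b where "a \<in> J" "x \<otimes> (p \<otimes> \<epsilon>) = \<theta> a" "b \<in> J" "y \<otimes> (p \<otimes> \<epsilon>) = \<theta> b"
          using xy p unfolding \<Psi>_def by blast
        then show ?thesis using xy p D
          by (auto simp: \<Psi>_def l_distr_minus m_closed emb_minus intro!: bexI[of _ "a \<ominus>\<^bsub>A\<^esub> b"])
      qed
      then show ?thesis using xy by (auto simp: \<Psi>_def r_distr_minus)
    qed
    have 2: "x \<otimes> r \<in> \<Psi> J" if x: "x \<in> \<Psi> J" and r: "r \<in> carrier R" for x r
    proof -
      have xR: "x \<in> carrier R" "\<epsilon> \<otimes> x = x" using x by (auto simp: \<Psi>_def)
      have "\<exists>a\<in>J. (x \<otimes> r) \<otimes> (p \<otimes> \<epsilon>) = \<theta> a" if p: "p \<in> carrier R" for p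
      proof -
        have "\<exists>a\<in>J. x \<otimes> ((r \<otimes> p) \<otimes> \<epsilon>) = \<theta> a"
          using x m_closed[OF r p] unfolding \<Psi>_def by blast
        then show ?thesis using r p xR by (simp add: m_assoc m_closed)
      qed
      moreover have "\<epsilon> \<otimes> (x \<otimes> r) = x \<otimes> r"
        using m_assoc[of \<epsilon> x r] xR r by simp
      ultimately show ?thesis using xR r by (auto simp: \<Psi>_def m_closed)
    qed
    show ?thesis unfolding right_ideal_def using 0 1 2 by (auto simp: \<Psi>_def)
  qed
  have mono: "\<Psi> J \<subseteq> \<Psi> J'" if "J \<subseteq> J'" for J J'
    using that by (fastforce simp: \<Psi>_def)
  have inj: "J' = J"
    if J: "right_ideal A J" "right_ideal A J'" and sub: "J \<subseteq> J'" and eq: "\<Psi> J' = \<Psi> J" for J J'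
  proof -
    note D = right_idealD[OF J(1)] and D' = right_idealD[OF J(2)]
    have "a \<in> J" if a: "a \<in> J'" for a
    proof -
      have aA: "a \<in> carrier A" using D' a by simp
      have "\<exists>c\<in>J'. \<theta> a \<otimes> (p \<otimes> \<epsilon>) = \<theta> c" if p: "p \<in> carrier R" for p
      proof -
        obtain b where b: "b \<in> carrier A" "\<theta> b = \<epsilon> \<otimes> (p \<otimes> \<epsilon>)" using emb_onto p by blast
        have "\<theta> a \<otimes> (p \<otimes> \<epsilon>) = (\<theta> a \<otimes> \<epsilon>) \<otimes> (p \<otimes> \<epsilon>)" by (simp add: emb_unit aA)
        also have "\<dots> = \<theta> (a \<otimes>\<^bsub>A\<^esub> b)"
          using aA b p by (simp add: m_assoc m_closed emb_closed emb_mult)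
        finally show ?thesis using D'(4)[OF a b(1)] by blast
      qed
      then have "\<theta> a \<in> \<Psi> J'" using aA by (auto simp: \<Psi>_def emb_closed emb_unit)
      then have "\<theta> a \<in> \<Psi> J" using eq by simp
      then obtain c where c: "c \<in> J" "\<theta> a \<otimes> (\<epsilon> \<otimes> \<epsilon>) = \<theta> c"
        using corner_unit_closed unfolding \<Psi>_def by blast
      then have "\<theta> a = \<theta> c" using aA emb_unit by simp
      then have "a = c" using emb_inj aA c D(1) by (auto simp: inj_on_def)
      then show ?thesis using c by simp
    qed
    then show ?thesis using sub by blast
  qed
  show ?thesis
    unfolding chain_reduces_def
    by (intro exI[of _ "1::nat"] exI[of _ "\<lambda>_. \<Psi>"])
      (use ideal mono inj in \<open>auto simp: \<Psi>_def\<close>)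
qed

lemma right_chain_conditions:
  assumes U: "U \<subseteq> carrier R" "\<epsilon> \<in> U"
  shows "(\<forall>u\<in>U. dcc_on {N. right_ideal R N \<and> (\<forall>x\<in>N. u \<otimes> x = x)}) \<longleftrightarrow> dcc_on {J. right_ideal A J}"
    and "(\<forall>u\<in>U. acc_on {N. right_ideal R N \<and> (\<forall>x\<in>N. u \<otimes> x = x)}) \<longleftrightarrow> acc_on {J. right_ideal A J}"
proof -
  have down: "chain_reduces {N. right_ideal R N \<and> (\<forall>x\<in>N. u \<otimes> x = x)} {J. right_ideal A J}"
    if "u \<in> U" for u
    using chain_reduces_right_ideals_to_corner U that by blast
  note up = chain_reduces_corner_to_right_ideals
  show "(\<forall>u\<in>U. dcc_on {N. right_ideal R N \<and> (\<forall>x\<in>N. u \<otimes> x = x)}) \<longleftrightarrow> dcc_on {J. right_ideal A J}"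
    using dcc_on_chain_reduces[OF up] dcc_on_chain_reduces[OF down] U(2) by blast
  show "(\<forall>u\<in>U. acc_on {N. right_ideal R N \<and> (\<forall>x\<in>N. u \<otimes> x = x)}) \<longleftrightarrow> acc_on {J. right_ideal A J}"
    using acc_on_chain_reduces[OF up] acc_on_chain_reduces[OF down] U(2) by blast
qed

end

section \<open>The ring of a preadditive category\<close>

lemma (in abelian_monoid) finsum_swap:
  assumes "\<And>i j. \<lbrakk> i \<in> I; j \<in> J \<rbrakk> \<Longrightarrow> f i j \<in> carrier G"
  shows "(\<Oplus>i\<in>I. \<Oplus>j\<in>J. f i j) = (\<Oplus>j\<in>J. \<Oplus>i\<in>I. f i j)"
  using assms
proof (induction I rule: infinite_finite_induct)
  case (infinite I)
  then show ?case by (simp add: finsum_infinite)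
next
  case empty
  then show ?case by simp
next
  case (insert i I)
  have "(\<Oplus>i'\<in>insert i I. \<Oplus>j\<in>J. f i' j) = (\<Oplus>j\<in>J. f i j) \<oplus> (\<Oplus>i\<in>I. \<Oplus>j\<in>J. f i j)"
    using insert by (intro finsum_insert) (auto intro!: finsum_closed)
  also have "\<dots> = (\<Oplus>j\<in>J. f i j \<oplus> (\<Oplus>i\<in>I. f i j))"
    using insert by (subst finsum_addf) (auto intro!: finsum_closed)
  also have "\<dots> = (\<Oplus>j\<in>J. \<Oplus>i\<in>insert i I. f i j)"
    using insert by (intro finsum_cong') (auto intro!: finsum_closed)
  finally show ?case .
qed

text \<open>
  The matrix unit notation: the family whose only possibly nonzero entry is \<open>f\<close>, in degree \<open>\<gamma>\<close>.
\<close>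

definition single :: "('o, 'm) cat \<Rightarrow> 'o \<times> 'o \<Rightarrow> 'm \<Rightarrow> 'o \<times> 'o \<Rightarrow> 'm" where
  "single C \<gamma> f =
    (\<lambda>\<delta>\<in>Ob C \<times> Ob C. if \<delta> = \<gamma> then f else \<zero>\<^bsub>Mor C (snd \<delta>) (fst \<delta>)\<^esub>)"

lemma single_entry:
  "\<lbrakk> X \<in> Ob C; Y \<in> Ob C \<rbrakk> \<Longrightarrow>
    single C \<gamma> f (X, Y) = (if (X, Y) = \<gamma> then f else \<zero>\<^bsub>Mor C Y X\<^esub>)"
  by (simp add: single_def)

lemma unit_at_cat_ring: "unit_at (cat_ring C) (X, X) = single C (X, X) (Ident C X)"
  by (auto simp: cat_ring_def single_def Let_def)

lemma base_cat_ring: "base (cat_ring C) = Ob C"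
  by (simp add: cat_ring_def Let_def)

context preadditive_category
begin

lemma carrier_cat_ring:
  "carrier (cat_ring C) = {f \<in> (\<Pi>\<^sub>E \<gamma>\<in>Ob C \<times> Ob C. carrier (Mor C (snd \<gamma>) (fst \<gamma>))).
    finite {\<gamma>\<in>Ob C \<times> Ob C. f \<gamma> \<noteq> \<zero>\<^bsub>Mor C (snd \<gamma>) (fst \<gamma>)\<^esub>}}"
  by (simp add: cat_ring_def Let_def)

lemma entry_closed:
  "\<lbrakk> f \<in> carrier (cat_ring C); X \<in> Ob C; Y \<in> Ob C \<rbrakk> \<Longrightarrow> f (X, Y) \<in> carrier (Mor C Y X)"
  by (force simp: carrier_cat_ring PiE_def Pi_def)

lemma cat_ring_eqI:
  assumes "f \<in> carrier (cat_ring C)" "g \<in> carrier (cat_ring C)"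
    and "\<And>X Y. \<lbrakk> X \<in> Ob C; Y \<in> Ob C \<rbrakk> \<Longrightarrow> f (X, Y) = g (X, Y)"
  shows "f = g"
  by (rule extensionalityI[of f "Ob C \<times> Ob C"])
    (use assms in \<open>auto simp: carrier_cat_ring PiE_def\<close>)

lemma cat_ring_support:
  assumes "f \<in> carrier (cat_ring C)"
  obtains T where "finite T" "T \<subseteq> Ob C"
    "\<And>X Y. \<lbrakk> X \<in> Ob C; Y \<in> Ob C; X \<notin> T \<or> Y \<notin> T \<rbrakk> \<Longrightarrow> f (X, Y) = \<zero>\<^bsub>Mor C Y X\<^esub>"
proof -
  let ?S = "{\<gamma>\<in>Ob C \<times> Ob C. f \<gamma> \<noteq> \<zero>\<^bsub>Mor C (snd \<gamma>) (fst \<gamma>)\<^esub>}"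
  have "finite ?S" using assms by (simp add: carrier_cat_ring)
  then show ?thesis by (intro that[of "fst ` ?S \<union> snd ` ?S"]) force+
qed

lemma carrier_cat_ringI:
  assumes "f \<in> extensional (Ob C \<times> Ob C)"
    and "\<And>X Y. \<lbrakk> X \<in> Ob C; Y \<in> Ob C \<rbrakk> \<Longrightarrow> f (X, Y) \<in> carrier (Mor C Y X)"
    and "finite T"
    and "\<And>X Y. \<lbrakk> X \<in> Ob C; Y \<in> Ob C; X \<notin> T \<or> Y \<notin> T \<rbrakk> \<Longrightarrow> f (X, Y) = \<zero>\<^bsub>Mor C Y X\<^esub>"
  shows "f \<in> carrier (cat_ring C)"
proof -
  have "{\<gamma>\<in>Ob C \<times> Ob C. f \<gamma> \<noteq> \<zero>\<^bsub>Mor C (snd \<gamma>) (fst \<gamma>)\<^esub>} \<subseteq> T \<times> T"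
    using assms(4) by force
  then have "finite {\<gamma>\<in>Ob C \<times> Ob C. f \<gamma> \<noteq> \<zero>\<^bsub>Mor C (snd \<gamma>) (fst \<gamma>)\<^esub>}"
    using assms(3) finite_subset by blast
  then show ?thesis using assms(1,2) by (auto simp: carrier_cat_ring PiE_def)
qed

lemma add_entry:
  "\<lbrakk> X \<in> Ob C; Y \<in> Ob C \<rbrakk> \<Longrightarrow> (f \<oplus>\<^bsub>cat_ring C\<^esub> g) (X, Y) = f (X, Y) \<oplus>\<^bsub>Mor C Y X\<^esub> g (X, Y)"
  by (simp add: cat_ring_def Let_def)

lemma zero_entry: "\<lbrakk> X \<in> Ob C; Y \<in> Ob C \<rbrakk> \<Longrightarrow> \<zero>\<^bsub>cat_ring C\<^esub> (X, Y) = \<zero>\<^bsub>Mor C Y X\<^esub>"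
  by (simp add: cat_ring_def Let_def)

lemma zero_closed_Mor: "\<lbrakk> X \<in> Ob C; Y \<in> Ob C \<rbrakk> \<Longrightarrow> \<zero>\<^bsub>Mor C X Y\<^esub> \<in> carrier (Mor C X Y)"
  using Mor_group abelian_group.axioms(1) abelian_monoid.zero_closed by blast

lemma Comp_zero_right:
  assumes "X \<in> Ob C" "Y \<in> Ob C" "Z \<in> Ob C" "g \<in> carrier (Mor C Y Z)"
  shows "Comp C X Y Z g \<zero>\<^bsub>Mor C X Y\<^esub> = \<zero>\<^bsub>Mor C X Z\<^esub>"
proof -
  interpret XY: abelian_group "Mor C X Y" using Mor_group assms by blast
  interpret XZ: abelian_group "Mor C X Z" using Mor_group assms by blast
  show ?thesis
    using Comp_add_right[OF assms(1-3) XY.zero_closed XY.zero_closed assms(4), symmetric]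
      Comp_closed[OF assms(1-3) XY.zero_closed assms(4)] XZ.add.r_cancel_one by simp
qed

lemma Comp_zero_left:
  assumes "X \<in> Ob C" "Y \<in> Ob C" "Z \<in> Ob C" "f \<in> carrier (Mor C X Y)"
  shows "Comp C X Y Z \<zero>\<^bsub>Mor C Y Z\<^esub> f = \<zero>\<^bsub>Mor C X Z\<^esub>"
proof -
  interpret YZ: abelian_group "Mor C Y Z" using Mor_group assms by blast
  interpret XZ: abelian_group "Mor C X Z" using Mor_group assms by blast
  show ?thesis
    using Comp_add_left[OF assms YZ.zero_closed YZ.zero_closed, symmetric]
      Comp_closed[OF assms YZ.zero_closed] XZ.add.r_cancel_one by simp
qed

lemma Comp_finsum_right:
  assumes "X \<in> Ob C" "Y \<in> Ob C" "Z \<in> Ob C" "g \<in> carrier (Mor C Y Z)"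
    and "\<And>i. i \<in> I \<Longrightarrow> f i \<in> carrier (Mor C X Y)"
  shows "Comp C X Y Z g (\<Oplus>\<^bsub>Mor C X Y\<^esub>i\<in>I. f i) = (\<Oplus>\<^bsub>Mor C X Z\<^esub>i\<in>I. Comp C X Y Z g (f i))"
proof -
  interpret XY: abelian_group "Mor C X Y" using Mor_group assms by blast
  interpret XZ: abelian_group "Mor C X Z" using Mor_group assms by blast
  show ?thesis
    using assms(5)
  proof (induction I rule: infinite_finite_induct)
    case (insert i I)
    then show ?case using assms(1-4)
      by (simp add: XY.finsum_insert XZ.finsum_insert Pi_def Comp_add_right Comp_closed
          XY.finsum_closed)
  qed (use assms in \<open>auto simp: Comp_zero_right XY.finsum_infinite XZ.finsum_infinite\<close>)
qed

lemma Comp_finsum_left: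
  assumes "X \<in> Ob C" "Y \<in> Ob C" "Z \<in> Ob C" "f \<in> carrier (Mor C X Y)"
    and "\<And>i. i \<in> I \<Longrightarrow> g i \<in> carrier (Mor C Y Z)"
  shows "Comp C X Y Z (\<Oplus>\<^bsub>Mor C Y Z\<^esub>i\<in>I. g i) f = (\<Oplus>\<^bsub>Mor C X Z\<^esub>i\<in>I. Comp C X Y Z (g i) f)"
proof -
  interpret YZ: abelian_group "Mor C Y Z" using Mor_group assms by blast
  interpret XZ: abelian_group "Mor C X Z" using Mor_group assms by blast
  show ?thesis
    using assms(5)
  proof (induction I rule: infinite_finite_induct)
    case (insert i I)
    then show ?case using assms(1-4)
      by (simp add: YZ.finsum_insert XZ.finsum_insert Pi_def Comp_add_left Comp_closed
          YZ.finsum_closed)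
  qed (use assms in \<open>auto simp: Comp_zero_left YZ.finsum_infinite XZ.finsum_infinite\<close>)
qed

text \<open>
  The product is defined by a sum over the support of the row of \<open>f\<close>. Since that index set depends on
  \<open>f\<close>, it is replaced by any finite set outside of which the summands vanish; sums belonging to
  different factors can then be taken over a common index set.
\<close>

lemma mult_entry:
  assumes "f \<in> carrier (cat_ring C)" "g \<in> carrier (cat_ring C)"
    and "X \<in> Ob C" "Z \<in> Ob C" "finite T" "T \<subseteq> Ob C"
    and "\<And>Y. \<lbrakk> Y \<in> Ob C; Y \<notin> T \<rbrakk> \<Longrightarrow> f (X, Y) = \<zero>\<^bsub>Mor C Y X\<^esub> \<or> g (Y, Z) = \<zero>\<^bsub>Mor C Z Y\<^esub>"
  shows "(f \<otimes>\<^bsub>cat_ring C\<^esub> g) (X, Z) = (\<Oplus>\<^bsub>Mor C Z X\<^esub>Y\<in>T. Comp C Z Y X (f (X, Y)) (g (Y, Z)))"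
proof -
  interpret ZX: abelian_group "Mor C Z X" using Mor_group assms by blast
  obtain S where S: "finite S" "S \<subseteq> Ob C"
    "\<And>X Y. \<lbrakk> X \<in> Ob C; Y \<in> Ob C; X \<notin> S \<or> Y \<notin> S \<rbrakk> \<Longrightarrow> f (X, Y) = \<zero>\<^bsub>Mor C Y X\<^esub>"
    using cat_ring_support[OF assms(1)] by blast
  have "{Y\<in>Ob C. f (X, Y) \<noteq> \<zero>\<^bsub>Mor C Y X\<^esub>} \<subseteq> S" using S(3) assms(3) by blast
  then have fin: "finite {Y\<in>Ob C. f (X, Y) \<noteq> \<zero>\<^bsub>Mor C Y X\<^esub>}"
    using S(1) finite_subset by blast
  have "(f \<otimes>\<^bsub>cat_ring C\<^esub> g) (X, Z) =
      (\<Oplus>\<^bsub>Mor C Z X\<^esub>Y\<in>{Y\<in>Ob C. f (X, Y) \<noteq> \<zero>\<^bsub>Mor C Y X\<^esub>}. Comp C Z Y X (f (X, Y)) (g (Y, Z)))"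
    using assms(3,4) by (simp add: cat_ring_def Let_def)
  also have "\<dots> = (\<Oplus>\<^bsub>Mor C Z X\<^esub>Y\<in>T. Comp C Z Y X (f (X, Y)) (g (Y, Z)))"
  proof (rule ZX.add.finprod_mono_neutral_cong)
    fix Y assume Y: "Y \<in> T - {Y\<in>Ob C. f (X, Y) \<noteq> \<zero>\<^bsub>Mor C Y X\<^esub>}"
    then show "Comp C Z Y X (f (X, Y)) (g (Y, Z)) = \<zero>\<^bsub>Mor C Z X\<^esub>"
      using assms by (auto simp: Comp_zero_left entry_closed subset_iff)
  next
    fix Y assume Y: "Y \<in> {Y\<in>Ob C. f (X, Y) \<noteq> \<zero>\<^bsub>Mor C Y X\<^esub>} - T"
    then have "g (Y, Z) = \<zero>\<^bsub>Mor C Z Y\<^esub>" using assms(7) by blast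
    then show "Comp C Z Y X (f (X, Y)) (g (Y, Z)) = \<zero>\<^bsub>Mor C Z X\<^esub>"
      using Y assms by (simp add: Comp_zero_right entry_closed)
  qed (use assms fin in \<open>auto simp: Comp_closed entry_closed subset_iff\<close>)
  finally show ?thesis .
qed

lemma mult_entry_one_term:
  assumes "f \<in> carrier (cat_ring C)" "g \<in> carrier (cat_ring C)"
    and "X \<in> Ob C" "Y \<in> Ob C" "Z \<in> Ob C"
    and "\<And>Y'. \<lbrakk> Y' \<in> Ob C; Y' \<noteq> Y \<rbrakk> \<Longrightarrow> f (X, Y') = \<zero>\<^bsub>Mor C Y' X\<^esub> \<or> g (Y', Z) = \<zero>\<^bsub>Mor C Z Y'\<^esub>"
  shows "(f \<otimes>\<^bsub>cat_ring C\<^esub> g) (X, Z) = Comp C Z Y X (f (X, Y)) (g (Y, Z))"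
proof -
  interpret ZX: abelian_group "Mor C Z X" using Mor_group assms by blast
  show ?thesis
    using assms Comp_closed[OF assms(5,4,3) entry_closed[OF assms(2,4,5)] entry_closed[OF assms(1,3,4)]]
    by (subst mult_entry[where T = "{Y}"]) (auto simp: ZX.finsum_insert)
qed

lemma mult_closed_cat_ring:
  assumes "f \<in> carrier (cat_ring C)" "g \<in> carrier (cat_ring C)"
  shows "f \<otimes>\<^bsub>cat_ring C\<^esub> g \<in> carrier (cat_ring C)"
proof -
  obtain S where S: "finite S" "S \<subseteq> Ob C"
    "\<And>X Y. \<lbrakk> X \<in> Ob C; Y \<in> Ob C; X \<notin> S \<or> Y \<notin> S \<rbrakk> \<Longrightarrow> f (X, Y) = \<zero>\<^bsub>Mor C Y X\<^esub>"
    using cat_ring_support[OF assms(1)] by blast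
  obtain T where T: "finite T" "T \<subseteq> Ob C"
    "\<And>X Y. \<lbrakk> X \<in> Ob C; Y \<in> Ob C; X \<notin> T \<or> Y \<notin> T \<rbrakk> \<Longrightarrow> g (X, Y) = \<zero>\<^bsub>Mor C Y X\<^esub>"
    using cat_ring_support[OF assms(2)] by blast
  show ?thesis
  proof (rule carrier_cat_ringI[where T = "S \<union> T"])
    show "f \<otimes>\<^bsub>cat_ring C\<^esub> g \<in> extensional (Ob C \<times> Ob C)"
      by (simp add: cat_ring_def Let_def)
  next
    fix X Z assume XZ: "X \<in> Ob C" "Z \<in> Ob C"
    interpret ZX: abelian_group "Mor C Z X" using Mor_group XZ by blast
    have eq: "(f \<otimes>\<^bsub>cat_ring C\<^esub> g) (X, Z) = (\<Oplus>\<^bsub>Mor C Z X\<^esub>Y\<in>S. Comp C Z Y X (f (X, Y)) (g (Y, Z)))"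
      using S XZ by (intro mult_entry assms) auto
    show "(f \<otimes>\<^bsub>cat_ring C\<^esub> g) (X, Z) \<in> carrier (Mor C Z X)"
      unfolding eq using XZ S(2)
      by (intro ZX.finsum_closed) (auto simp: Comp_closed entry_closed assms subset_iff)
    assume "X \<notin> S \<union> T \<or> Z \<notin> S \<union> T"
    then have "f (X, Y) = \<zero>\<^bsub>Mor C Y X\<^esub> \<or> g (Y, Z) = \<zero>\<^bsub>Mor C Z Y\<^esub>" if "Y \<in> Ob C" for Y
      using S(3)[OF XZ(1) that] T(3)[OF that XZ(2)] by blast
    then show "(f \<otimes>\<^bsub>cat_ring C\<^esub> g) (X, Z) = \<zero>\<^bsub>Mor C Z X\<^esub>"
      using mult_entry[OF assms XZ, of "{}"] by simp
  qed (use S T in auto)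
qed

lemma abelian_group_cat_ring: "abelian_group (cat_ring C)"
proof (rule abelian_groupI)
  have grp: "abelian_group (Mor C X Y)" if "X \<in> Ob C" "Y \<in> Ob C" for X Y
    using that Mor_group by blast
  have closed: "f \<oplus>\<^bsub>cat_ring C\<^esub> g \<in> carrier (cat_ring C)"
    if fg: "f \<in> carrier (cat_ring C)" "g \<in> carrier (cat_ring C)" for f g
  proof -
    obtain S where S: "finite S" "S \<subseteq> Ob C"
      "\<And>X Y. \<lbrakk> X \<in> Ob C; Y \<in> Ob C; X \<notin> S \<or> Y \<notin> S \<rbrakk> \<Longrightarrow> f (X, Y) = \<zero>\<^bsub>Mor C Y X\<^esub>"
      using cat_ring_support[OF fg(1)] by blast
    obtain T where T: "finite T" "T \<subseteq> Ob C"
      "\<And>X Y. \<lbrakk> X \<in> Ob C; Y \<in> Ob C; X \<notin> T \<or> Y \<notin> T \<rbrakk> \<Longrightarrow> g (X, Y) = \<zero>\<^bsub>Mor C Y X\<^esub>"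
      using cat_ring_support[OF fg(2)] by blast
    show ?thesis
    proof (rule carrier_cat_ringI[where T = "S \<union> T"])
      show "f \<oplus>\<^bsub>cat_ring C\<^esub> g \<in> extensional (Ob C \<times> Ob C)"
        by (simp add: cat_ring_def Let_def)
    next
      fix X Y assume XY: "X \<in> Ob C" "Y \<in> Ob C"
      interpret YX: abelian_group "Mor C Y X" using grp XY by blast
      show "(f \<oplus>\<^bsub>cat_ring C\<^esub> g) (X, Y) \<in> carrier (Mor C Y X)"
        using XY fg by (simp add: add_entry entry_closed)
      assume "X \<notin> S \<union> T \<or> Y \<notin> S \<union> T"
      then show "(f \<oplus>\<^bsub>cat_ring C\<^esub> g) (X, Y) = \<zero>\<^bsub>Mor C Y X\<^esub>"
        using S(3)[OF XY] T(3)[OF XY] XY by (auto simp: add_entry)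
    qed (use S T in auto)
  qed
  show zero: "\<zero>\<^bsub>cat_ring C\<^esub> \<in> carrier (cat_ring C)"
    by (rule carrier_cat_ringI[where T = "{}"])
      (auto simp: zero_entry zero_closed_Mor, simp add: cat_ring_def Let_def)
  show "f \<oplus>\<^bsub>cat_ring C\<^esub> g \<in> carrier (cat_ring C)"
    if "f \<in> carrier (cat_ring C)" "g \<in> carrier (cat_ring C)" for f g
    using closed that .
  show "f \<oplus>\<^bsub>cat_ring C\<^esub> g \<oplus>\<^bsub>cat_ring C\<^esub> h = f \<oplus>\<^bsub>cat_ring C\<^esub> (g \<oplus>\<^bsub>cat_ring C\<^esub> h)"
    if "f \<in> carrier (cat_ring C)" "g \<in> carrier (cat_ring C)" "h \<in> carrier (cat_ring C)" for f g h
    by (rule cat_ring_eqI)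
      (use that in \<open>auto simp: closed add_entry entry_closed grp
        intro!: abelian_monoid.a_assoc abelian_group.axioms(1)\<close>)
  show "f \<oplus>\<^bsub>cat_ring C\<^esub> g = g \<oplus>\<^bsub>cat_ring C\<^esub> f"
    if "f \<in> carrier (cat_ring C)" "g \<in> carrier (cat_ring C)" for f g
    by (rule cat_ring_eqI)
      (use that in \<open>auto simp: closed add_entry entry_closed grp
        intro!: abelian_monoid.a_comm abelian_group.axioms(1)\<close>)
  show "\<zero>\<^bsub>cat_ring C\<^esub> \<oplus>\<^bsub>cat_ring C\<^esub> f = f" if "f \<in> carrier (cat_ring C)" for f
    by (rule cat_ring_eqI)
      (use that zero in \<open>auto simp: closed add_entry zero_entry entry_closed grp
        intro!: abelian_monoid.l_zero abelian_group.axioms(1)\<close>)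
  show "\<exists>g\<in>carrier (cat_ring C). g \<oplus>\<^bsub>cat_ring C\<^esub> f = \<zero>\<^bsub>cat_ring C\<^esub>"
    if f: "f \<in> carrier (cat_ring C)" for f
  proof -
    define g where "g = (\<lambda>\<gamma>\<in>Ob C \<times> Ob C. \<ominus>\<^bsub>Mor C (snd \<gamma>) (fst \<gamma>)\<^esub> f \<gamma>)"
    obtain S where S: "finite S" "S \<subseteq> Ob C"
      "\<And>X Y. \<lbrakk> X \<in> Ob C; Y \<in> Ob C; X \<notin> S \<or> Y \<notin> S \<rbrakk> \<Longrightarrow> f (X, Y) = \<zero>\<^bsub>Mor C Y X\<^esub>"
      using cat_ring_support[OF f] by blast
    have g: "g \<in> carrier (cat_ring C)"
    proof (rule carrier_cat_ringI[OF _ _ S(1)])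
      fix X Y assume XY: "X \<in> Ob C" "Y \<in> Ob C"
      interpret YX: abelian_group "Mor C Y X" using grp XY by blast
      show "g (X, Y) \<in> carrier (Mor C Y X)" using XY f by (simp add: g_def entry_closed)
      show "g (X, Y) = \<zero>\<^bsub>Mor C Y X\<^esub>" if "X \<notin> S \<or> Y \<notin> S"
        using S(3)[OF XY that] XY by (simp add: g_def)
    qed (simp add: g_def)
    have "g \<oplus>\<^bsub>cat_ring C\<^esub> f = \<zero>\<^bsub>cat_ring C\<^esub>"
    proof (rule cat_ring_eqI[OF closed[OF g f] zero])
      fix X Y assume XY: "X \<in> Ob C" "Y \<in> Ob C"
      interpret YX: abelian_group "Mor C Y X" using grp XY by blast
      show "(g \<oplus>\<^bsub>cat_ring C\<^esub> f) (X, Y) = \<zero>\<^bsub>cat_ring C\<^esub> (X, Y)"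
        using XY f by (simp add: add_entry zero_entry g_def entry_closed YX.l_neg)
    qed
    then show ?thesis using g by blast
  qed
qed

text \<open>
  Matrix multiplication is associative: with the inner index confined to the support \<open>S\<close> of \<open>f\<close> and
  the outer one to the support \<open>T\<close> of \<open>h\<close>, both products become the same finite double sum.
\<close>

lemma rng_cat_ring: "rng (cat_ring C)"
proof -
  interpret abelian_group "cat_ring C" by (rule abelian_group_cat_ring)
  note closed = mult_closed_cat_ring
  have sum: "(f \<otimes>\<^bsub>cat_ring C\<^esub> g) (X, Z) = (\<Oplus>\<^bsub>Mor C Z X\<^esub>Y\<in>T. Comp C Z Y X (f (X, Y)) (g (Y, Z)))"
    if "f \<in> carrier (cat_ring C)" "g \<in> carrier (cat_ring C)" "X \<in> Ob C" "Z \<in> Ob C"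
      "finite T" "T \<subseteq> Ob C"
      "(\<forall>Y\<in>Ob C. Y \<notin> T \<longrightarrow> f (X, Y) = \<zero>\<^bsub>Mor C Y X\<^esub>) \<or> (\<forall>Y\<in>Ob C. Y \<notin> T \<longrightarrow> g (Y, Z) = \<zero>\<^bsub>Mor C Z Y\<^esub>)"
    for f g X Z T
    using that by (intro mult_entry) auto
  show ?thesis
  proof unfold_locales
    fix f g h
    assume fgh: "f \<in> carrier (cat_ring C)" "g \<in> carrier (cat_ring C)" "h \<in> carrier (cat_ring C)"
    obtain S where S: "finite S" "S \<subseteq> Ob C"
      "\<And>X Y. \<lbrakk> X \<in> Ob C; Y \<in> Ob C; X \<notin> S \<or> Y \<notin> S \<rbrakk> \<Longrightarrow> f (X, Y) = \<zero>\<^bsub>Mor C Y X\<^esub>"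
      using cat_ring_support[OF fgh(1)] by blast
    obtain T where T: "finite T" "T \<subseteq> Ob C"
      "\<And>X Y. \<lbrakk> X \<in> Ob C; Y \<in> Ob C; X \<notin> T \<or> Y \<notin> T \<rbrakk> \<Longrightarrow> h (X, Y) = \<zero>\<^bsub>Mor C Y X\<^esub>"
      using cat_ring_support[OF fgh(3)] by blast
    show "f \<otimes>\<^bsub>cat_ring C\<^esub> g \<otimes>\<^bsub>cat_ring C\<^esub> h = f \<otimes>\<^bsub>cat_ring C\<^esub> (g \<otimes>\<^bsub>cat_ring C\<^esub> h)"
    proof (rule cat_ring_eqI)
      fix W Z assume WZ: "W \<in> Ob C" "Z \<in> Ob C"
      interpret ZW: abelian_group "Mor C Z W" using Mor_group WZ by blast
      let ?t = "\<lambda>V Y. Comp C Z V W (f (W, V)) (Comp C Z Y V (g (V, Y)) (h (Y, Z)))"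
      have "(f \<otimes>\<^bsub>cat_ring C\<^esub> g \<otimes>\<^bsub>cat_ring C\<^esub> h) (W, Z) =
          (\<Oplus>\<^bsub>Mor C Z W\<^esub>Y\<in>T. Comp C Z Y W ((f \<otimes>\<^bsub>cat_ring C\<^esub> g) (W, Y)) (h (Y, Z)))"
        using T WZ fgh by (intro sum closed) auto
      also have "\<dots> = (\<Oplus>\<^bsub>Mor C Z W\<^esub>Y\<in>T. \<Oplus>\<^bsub>Mor C Z W\<^esub>V\<in>S. ?t V Y)"
      proof (intro ZW.finsum_cong' refl)
        fix Y assume "Y \<in> T"
        then have Y: "Y \<in> Ob C" using T by auto
        have "(f \<otimes>\<^bsub>cat_ring C\<^esub> g) (W, Y) = (\<Oplus>\<^bsub>Mor C Y W\<^esub>V\<in>S. Comp C Y V W (f (W, V)) (g (V, Y)))"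
          using S WZ Y fgh by (intro sum) auto
        then show "Comp C Z Y W ((f \<otimes>\<^bsub>cat_ring C\<^esub> g) (W, Y)) (h (Y, Z)) = (\<Oplus>\<^bsub>Mor C Z W\<^esub>V\<in>S. ?t V Y)"
          using WZ Y S(2) fgh
          by (auto simp: Comp_finsum_left Comp_assoc Comp_closed entry_closed subset_iff
              intro!: ZW.finsum_cong')
      qed (use WZ S T fgh in \<open>auto simp: Comp_closed entry_closed subset_iff intro!: ZW.finsum_closed\<close>)
      also have "\<dots> = (\<Oplus>\<^bsub>Mor C Z W\<^esub>V\<in>S. \<Oplus>\<^bsub>Mor C Z W\<^esub>Y\<in>T. ?t V Y)"
        using WZ S T fgh
        by (intro ZW.finsum_swap) (auto simp: Comp_closed entry_closed subset_iff)
      also have "\<dots> = (\<Oplus>\<^bsub>Mor C Z W\<^esub>V\<in>S. Comp C Z V W (f (W, V)) ((g \<otimes>\<^bsub>cat_ring C\<^esub> h) (V, Z)))"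
      proof (intro ZW.finsum_cong' refl)
        fix V assume "V \<in> S"
        then have V: "V \<in> Ob C" using S by auto
        have "(g \<otimes>\<^bsub>cat_ring C\<^esub> h) (V, Z) = (\<Oplus>\<^bsub>Mor C Z V\<^esub>Y\<in>T. Comp C Z Y V (g (V, Y)) (h (Y, Z)))"
          using T WZ V fgh by (intro sum) auto
        then show "(\<Oplus>\<^bsub>Mor C Z W\<^esub>Y\<in>T. ?t V Y) = Comp C Z V W (f (W, V)) ((g \<otimes>\<^bsub>cat_ring C\<^esub> h) (V, Z))"
          using WZ V T(2) fgh
          by (auto simp: Comp_finsum_right Comp_closed entry_closed subset_iff)
      qed (use WZ S T fgh closed in \<open>auto simp: Comp_closed entry_closed subset_iff\<close>)
      also have "\<dots> = (f \<otimes>\<^bsub>cat_ring C\<^esub> (g \<otimes>\<^bsub>cat_ring C\<^esub> h)) (W, Z)"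
        using S WZ fgh by (intro sum[symmetric] closed) auto
      finally show "(f \<otimes>\<^bsub>cat_ring C\<^esub> g \<otimes>\<^bsub>cat_ring C\<^esub> h) (W, Z) =
        (f \<otimes>\<^bsub>cat_ring C\<^esub> (g \<otimes>\<^bsub>cat_ring C\<^esub> h)) (W, Z)" .
    qed (use fgh closed in auto)
    show "(f \<oplus>\<^bsub>cat_ring C\<^esub> g) \<otimes>\<^bsub>cat_ring C\<^esub> h = f \<otimes>\<^bsub>cat_ring C\<^esub> h \<oplus>\<^bsub>cat_ring C\<^esub> g \<otimes>\<^bsub>cat_ring C\<^esub> h"
    proof (rule cat_ring_eqI)
      fix X Z assume XZ: "X \<in> Ob C" "Z \<in> Ob C"
      interpret ZX: abelian_group "Mor C Z X" using Mor_group XZ by blast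
      have "((f \<oplus>\<^bsub>cat_ring C\<^esub> g) \<otimes>\<^bsub>cat_ring C\<^esub> h) (X, Z) =
          (\<Oplus>\<^bsub>Mor C Z X\<^esub>Y\<in>T. Comp C Z Y X ((f \<oplus>\<^bsub>cat_ring C\<^esub> g) (X, Y)) (h (Y, Z)))"
        using T XZ fgh by (intro sum) auto
      also have "\<dots> = (\<Oplus>\<^bsub>Mor C Z X\<^esub>Y\<in>T. Comp C Z Y X (f (X, Y)) (h (Y, Z)) \<oplus>\<^bsub>Mor C Z X\<^esub>
          Comp C Z Y X (g (X, Y)) (h (Y, Z)))"
        using T(2) XZ fgh
        by (intro ZX.finsum_cong' refl)
          (auto simp: add_entry Comp_add_left Comp_closed entry_closed subset_iff)
      also have "\<dots> = (f \<otimes>\<^bsub>cat_ring C\<^esub> h \<oplus>\<^bsub>cat_ring C\<^esub> g \<otimes>\<^bsub>cat_ring C\<^esub> h) (X, Z)"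
        using T XZ fgh
        by (subst ZX.finsum_addf)
          (auto simp: add_entry sum[where T = T] Comp_closed entry_closed subset_iff)
      finally show "((f \<oplus>\<^bsub>cat_ring C\<^esub> g) \<otimes>\<^bsub>cat_ring C\<^esub> h) (X, Z) =
        (f \<otimes>\<^bsub>cat_ring C\<^esub> h \<oplus>\<^bsub>cat_ring C\<^esub> g \<otimes>\<^bsub>cat_ring C\<^esub> h) (X, Z)" .
    qed (use fgh closed in auto)
    show "h \<otimes>\<^bsub>cat_ring C\<^esub> (f \<oplus>\<^bsub>cat_ring C\<^esub> g) = h \<otimes>\<^bsub>cat_ring C\<^esub> f \<oplus>\<^bsub>cat_ring C\<^esub> h \<otimes>\<^bsub>cat_ring C\<^esub> g"
    proof (rule cat_ring_eqI)
      fix X Z assume XZ: "X \<in> Ob C" "Z \<in> Ob C"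
      interpret ZX: abelian_group "Mor C Z X" using Mor_group XZ by blast
      have "(h \<otimes>\<^bsub>cat_ring C\<^esub> (f \<oplus>\<^bsub>cat_ring C\<^esub> g)) (X, Z) =
          (\<Oplus>\<^bsub>Mor C Z X\<^esub>Y\<in>T. Comp C Z Y X (h (X, Y)) ((f \<oplus>\<^bsub>cat_ring C\<^esub> g) (Y, Z)))"
        using T XZ fgh by (intro sum) auto
      also have "\<dots> = (\<Oplus>\<^bsub>Mor C Z X\<^esub>Y\<in>T. Comp C Z Y X (h (X, Y)) (f (Y, Z)) \<oplus>\<^bsub>Mor C Z X\<^esub>
          Comp C Z Y X (h (X, Y)) (g (Y, Z)))"
        using T(2) XZ fgh
        by (intro ZX.finsum_cong' refl)
          (auto simp: add_entry Comp_add_right Comp_closed entry_closed subset_iff)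
      also have "\<dots> = (h \<otimes>\<^bsub>cat_ring C\<^esub> f \<oplus>\<^bsub>cat_ring C\<^esub> h \<otimes>\<^bsub>cat_ring C\<^esub> g) (X, Z)"
        using T XZ fgh
        by (subst ZX.finsum_addf)
          (auto simp: add_entry sum[where T = T] Comp_closed entry_closed subset_iff)
      finally show "(h \<otimes>\<^bsub>cat_ring C\<^esub> (f \<oplus>\<^bsub>cat_ring C\<^esub> g)) (X, Z) =
        (h \<otimes>\<^bsub>cat_ring C\<^esub> f \<oplus>\<^bsub>cat_ring C\<^esub> h \<otimes>\<^bsub>cat_ring C\<^esub> g) (X, Z)" .
    qed (use fgh closed in auto)
  qed (use closed in auto)
qed

end

section \<open>Graded submodules of the ring of a category\<close>

lemma (in rng) submodule_right_principal_iff: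
  assumes u: "u \<in> carrier R" "u \<otimes> u = u"
  shows "submodule N R ((right_regular R)\<lparr>carrier := (\<lambda>x. u \<otimes> x) ` carrier R\<rparr>) \<longleftrightarrow>
    right_ideal R N \<and> (\<forall>x\<in>N. u \<otimes> x = x)"
proof -
  let ?M = "(right_regular R)\<lparr>carrier := (\<lambda>x. u \<otimes> x) ` carrier R\<rparr>"
  have "u \<otimes> (u \<otimes> x) = u \<otimes> x" if "x \<in> carrier R" for x
    using m_assoc[of u u x] u that by simp
  then have K: "carrier ?M = {x\<in>carrier R. u \<otimes> x = x}"
    using u by (force simp: m_closed image_iff)
  have "subgroup N (add_monoid ?M) \<longleftrightarrow>
      N \<subseteq> carrier ?M \<and> \<zero> \<in> N \<and> (\<forall>x\<in>N. \<forall>y\<in>N. x \<ominus> y \<in> N)"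
    by (rule subgroup_restrict_iff, unfold K)
      (use u in \<open>auto simp: right_regular_def m_zero_right r_distr_minus\<close>)
  then show ?thesis
    unfolding submodule_def submodule_axioms_def right_ideal_def K by (auto simp: right_regular_def)
qed

lemma (in rng) submodule_left_principal_iff:
  assumes u: "u \<in> carrier R" "u \<otimes> u = u"
  shows "submodule N R ((left_regular R)\<lparr>carrier := (\<lambda>x. x \<otimes> u) ` carrier R\<rparr>) \<longleftrightarrow>
    right_ideal (opposite_ring R) N \<and> (\<forall>x\<in>N. u \<otimes>\<^bsub>opposite_ring R\<^esub> x = x)"
proof -
  interpret op: rng "opposite_ring R" using rng_opposite_ring rng_axioms .
  have "submodule N R ((left_regular R)\<lparr>carrier := (\<lambda>x. x \<otimes> u) ` carrier R\<rparr>) \<longleftrightarrow>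
    submodule N (opposite_ring R) ((right_regular (opposite_ring R))
      \<lparr>carrier := (\<lambda>x. u \<otimes>\<^bsub>opposite_ring R\<^esub> x) ` carrier (opposite_ring R)\<rparr>)"
    by (simp add: submodule_def submodule_axioms_def left_regular_def right_regular_def opposite_ring_def)
  then show ?thesis using op.submodule_right_principal_iff[of u N] u by simp
qed

context preadditive_category
begin

interpretation R: rng "cat_ring C" by (rule rng_cat_ring)

lemma homog_cat_ring:
  "homog (cat_ring C) \<gamma> = {f \<in> carrier (cat_ring C).
    \<forall>X\<in>Ob C. \<forall>Y\<in>Ob C. (X, Y) \<noteq> \<gamma> \<longrightarrow> f (X, Y) = \<zero>\<^bsub>Mor C Y X\<^esub>}"
  by (auto simp: cat_ring_def Let_def)

lemma single_closed:
  assumes "X \<in> Ob C" "Y \<in> Ob C" "f \<in> carrier (Mor C Y X)"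
  shows "single C (X, Y) f \<in> carrier (cat_ring C)"
  by (rule carrier_cat_ringI[where T = "{X, Y}"])
    (use assms in \<open>auto simp: single_entry zero_closed_Mor, simp add: single_def\<close>)

lemma single_homog:
  assumes "X \<in> Ob C" "Y \<in> Ob C" "f \<in> carrier (Mor C Y X)"
  shows "single C (X, Y) f \<in> homog (cat_ring C) (X, Y)"
  using assms by (simp add: homog_cat_ring single_closed single_entry)

lemma homog_eq_single:
  assumes "X \<in> Ob C" "Y \<in> Ob C" "f \<in> homog (cat_ring C) (X, Y)"
  shows "single C (X, Y) (f (X, Y)) = f"
  by (rule cat_ring_eqI)
    (use assms in \<open>auto simp: homog_cat_ring single_closed single_entry entry_closed\<close>)

lemma single_zero: "\<lbrakk> X \<in> Ob C; Y \<in> Ob C \<rbrakk> \<Longrightarrow> single C (X, Y) \<zero>\<^bsub>Mor C Y X\<^esub> = \<zero>\<^bsub>cat_ring C\<^esub>"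
  by (rule cat_ring_eqI) (auto simp: single_closed single_entry zero_entry zero_closed_Mor)

lemma single_add:
  assumes "X \<in> Ob C" "Y \<in> Ob C" "f \<in> carrier (Mor C Y X)" "g \<in> carrier (Mor C Y X)"
  shows "single C (X, Y) (f \<oplus>\<^bsub>Mor C Y X\<^esub> g) = single C (X, Y) f \<oplus>\<^bsub>cat_ring C\<^esub> single C (X, Y) g"
proof (rule cat_ring_eqI)
  interpret YX: abelian_group "Mor C Y X" using Mor_group assms by blast
  show "single C (X, Y) (f \<oplus>\<^bsub>Mor C Y X\<^esub> g) \<in> carrier (cat_ring C)"
    using assms by (intro single_closed) auto
  fix X' Y' assume XY': "X' \<in> Ob C" "Y' \<in> Ob C"
  interpret YX': abelian_group "Mor C Y' X'" using Mor_group XY' by blast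
  show "single C (X, Y) (f \<oplus>\<^bsub>Mor C Y X\<^esub> g) (X', Y') =
      (single C (X, Y) f \<oplus>\<^bsub>cat_ring C\<^esub> single C (X, Y) g) (X', Y')"
    using XY' by (auto simp: single_entry add_entry)
qed (use assms in \<open>auto simp: single_closed\<close>)

lemma mult_single_entry:
  assumes "r \<in> carrier (cat_ring C)" "X \<in> Ob C" "Y \<in> Ob C" "Z \<in> Ob C" "Z' \<in> Ob C"
    and "g \<in> carrier (Mor C Z Y)"
  shows "(r \<otimes>\<^bsub>cat_ring C\<^esub> single C (Y, Z) g) (X, Z') =
    (if Z' = Z then Comp C Z Y X (r (X, Y)) g else \<zero>\<^bsub>Mor C Z' X\<^esub>)"
  using assms
  by (subst mult_entry_one_term[where Y = Y])
    (auto simp: single_closed single_entry Comp_zero_right entry_closed)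

lemma single_mult_entry:
  assumes "r \<in> carrier (cat_ring C)" "X \<in> Ob C" "Y \<in> Ob C" "Z \<in> Ob C" "X' \<in> Ob C"
    and "f \<in> carrier (Mor C Y X)"
  shows "(single C (X, Y) f \<otimes>\<^bsub>cat_ring C\<^esub> r) (X', Z) =
    (if X' = X then Comp C Z Y X f (r (Y, Z)) else \<zero>\<^bsub>Mor C Z X'\<^esub>)"
  using assms
  by (subst mult_entry_one_term[where Y = Y])
    (auto simp: single_closed single_entry Comp_zero_left entry_closed)

lemma single_mult_single:
  assumes "X \<in> Ob C" "Y \<in> Ob C" "Z \<in> Ob C" "f \<in> carrier (Mor C Y X)" "g \<in> carrier (Mor C Z Y)"
  shows "single C (X, Y) f \<otimes>\<^bsub>cat_ring C\<^esub> single C (Y, Z) g = single C (X, Z) (Comp C Z Y X f g)"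
  by (rule cat_ring_eqI)
    (use assms in \<open>auto simp: single_closed single_entry single_mult_entry mult_closed_cat_ring
      Comp_closed Comp_zero_right\<close>)

lemma unit_at_closed: "X \<in> Ob C \<Longrightarrow> unit_at (cat_ring C) (X, X) \<in> carrier (cat_ring C)"
  by (simp add: unit_at_cat_ring single_closed Ident_closed)

lemma unit_at_idem:
  "X \<in> Ob C \<Longrightarrow> unit_at (cat_ring C) (X, X) \<otimes>\<^bsub>cat_ring C\<^esub> unit_at (cat_ring C) (X, X) =
    unit_at (cat_ring C) (X, X)"
  by (simp add: unit_at_cat_ring single_mult_single Ident_closed Ident_left)

lemma finsum_entry:
  assumes "finite J" "c \<in> J \<rightarrow> carrier (cat_ring C)" "X \<in> Ob C" "Y \<in> Ob C"
  shows "(\<Oplus>\<^bsub>cat_ring C\<^esub>j\<in>J. c j) (X, Y) = (\<Oplus>\<^bsub>Mor C Y X\<^esub>j\<in>J. c j (X, Y))"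
proof -
  interpret YX: abelian_group "Mor C Y X" using Mor_group assms by blast
  show ?thesis using assms(1,2)
  proof induction
    case empty
    show ?case using assms by (simp add: zero_entry)
  next
    case (insert j J)
    then show ?case using assms(3,4)
      by (simp add: R.finsum_insert YX.finsum_insert add_entry entry_closed Pi_def)
  qed
qed

text \<open>
  A family of homogeneous elements is recovered from its sum by reading off the entries, so a subgroup is the direct sum of
  its homogeneous parts as soon as it contains the homogeneous components of its elements.
\<close>

lemma internal_direct_sum_homog:
  assumes N: "N \<subseteq> carrier (cat_ring C)" "\<zero>\<^bsub>cat_ring C\<^esub> \<in> N"
      "\<And>x y. \<lbrakk> x \<in> N; y \<in> N \<rbrakk> \<Longrightarrow> x \<oplus>\<^bsub>cat_ring C\<^esub> y \<in> N"
    and comp: "\<And>f X Y. \<lbrakk> f \<in> N; X \<in> Ob C; Y \<in> Ob C \<rbrakk> \<Longrightarrow> single C (X, Y) (f (X, Y)) \<in> N"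
  shows "internal_direct_sum (cat_ring C) (Ob C \<times> Ob C) (\<lambda>\<gamma>. N \<inter> homog (cat_ring C) \<gamma>) N"
proof -
  let ?\<Gamma> = "Ob C \<times> Ob C" and ?R = "cat_ring C"
  let ?D = "{c \<in> (\<Pi>\<^sub>E \<gamma>\<in>?\<Gamma>. N \<inter> homog ?R \<gamma>). finite {\<gamma>\<in>?\<Gamma>. c \<gamma> \<noteq> \<zero>\<^bsub>?R\<^esub>}}"
  let ?sum = "\<lambda>c. \<Oplus>\<^bsub>?R\<^esub>\<gamma>\<in>{\<gamma>\<in>?\<Gamma>. c \<gamma> \<noteq> \<zero>\<^bsub>?R\<^esub>}. c \<gamma>"
  let ?split = "\<lambda>f. \<lambda>\<gamma>\<in>?\<Gamma>. single C \<gamma> (f \<gamma>)"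
  have homog: "c (X, Y) \<in> N" "c (X, Y) \<in> homog ?R (X, Y)" "c (X, Y) \<in> carrier ?R"
    if "c \<in> ?D" "X \<in> Ob C" "Y \<in> Ob C" for c X Y
    using that N by (auto simp: PiE_def Pi_def)
  have sum_closed: "?sum c \<in> N" if c: "c \<in> ?D" for c
  proof -
    have "(\<Oplus>\<^bsub>?R\<^esub>\<gamma>\<in>J. c \<gamma>) \<in> N" if "finite J" "J \<subseteq> ?\<Gamma>" for J
      using that
    proof induction
      case empty
      then show ?case using N by simp
    next
      case (insert \<gamma> J)
      have "c j \<in> N" "c j \<in> carrier ?R" if "j \<in> insert \<gamma> J" for j
        using insert.prems that homog[OF c] by force+
      then show ?case using insert N(3)
        by (subst R.finsum_insert) auto
    qed
    then show ?thesis using c by auto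
  qed
  have sum_entry: "?sum c (X, Y) = c (X, Y) (X, Y)"
    if c: "c \<in> ?D" and XY: "X \<in> Ob C" "Y \<in> Ob C" for c X Y
  proof -
    interpret YX: abelian_group "Mor C Y X" using Mor_group XY by blast
    have "?sum c (X, Y) = (\<Oplus>\<^bsub>Mor C Y X\<^esub>\<gamma>\<in>{\<gamma>\<in>?\<Gamma>. c \<gamma> \<noteq> \<zero>\<^bsub>?R\<^esub>}. c \<gamma> (X, Y))"
      using c XY homog[OF c] by (intro finsum_entry) auto
    also have "\<dots> = (\<Oplus>\<^bsub>Mor C Y X\<^esub>\<gamma>\<in>{(X, Y)}. c \<gamma> (X, Y))"
    proof (rule YX.add.finprod_mono_neutral_cong)
      fix \<gamma> assume \<gamma>: "\<gamma> \<in> {\<gamma>\<in>?\<Gamma>. c \<gamma> \<noteq> \<zero>\<^bsub>?R\<^esub>} - {(X, Y)}"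
      then have "c \<gamma> \<in> homog ?R \<gamma>" using homog(2)[OF c] by auto
      then show "c \<gamma> (X, Y) = \<zero>\<^bsub>Mor C Y X\<^esub>" using \<gamma> XY by (auto simp: homog_cat_ring)
    qed (use c XY homog[OF c] in \<open>auto simp: zero_entry entry_closed\<close>)
    also have "\<dots> = c (X, Y) (X, Y)"
      using XY homog[OF c XY] by (subst YX.finsum_insert) (auto simp: entry_closed)
    finally show ?thesis .
  qed
  have split: "?split f \<in> ?D" if f: "f \<in> N" for f
  proof -
    have fR: "f \<in> carrier ?R" using f N by auto
    have "{\<gamma>\<in>?\<Gamma>. ?split f \<gamma> \<noteq> \<zero>\<^bsub>?R\<^esub>} \<subseteq>
        {\<gamma>\<in>?\<Gamma>. f \<gamma> \<noteq> \<zero>\<^bsub>Mor C (snd \<gamma>) (fst \<gamma>)\<^esub>}"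
      by (auto simp: single_zero)
    moreover have "finite {\<gamma>\<in>?\<Gamma>. f \<gamma> \<noteq> \<zero>\<^bsub>Mor C (snd \<gamma>) (fst \<gamma>)\<^esub>}"
      using fR by (simp add: carrier_cat_ring)
    ultimately have "finite {\<gamma>\<in>?\<Gamma>. ?split f \<gamma> \<noteq> \<zero>\<^bsub>?R\<^esub>}"
      by (rule finite_subset)
    moreover have "?split f \<in> (\<Pi>\<^sub>E \<gamma>\<in>?\<Gamma>. N \<inter> homog ?R \<gamma>)"
      using comp[OF f] fR by (auto simp: single_homog entry_closed)
    ultimately show ?thesis by blast
  qed
  show ?thesis
    unfolding internal_direct_sum_def
  proof (rule bij_betw_byWitness[where f' = ?split])
    show "\<forall>c\<in>?D. ?split (?sum c) = c"
    proof
      fix c assume c: "c \<in> ?D"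
      show "?split (?sum c) = c"
      proof (rule extensionalityI[of _ ?\<Gamma>])
        fix \<gamma> assume "\<gamma> \<in> ?\<Gamma>"
        then show "?split (?sum c) \<gamma> = c \<gamma>"
          using sum_entry[OF c] homog_eq_single homog(2)[OF c] by auto
      qed (use c in \<open>auto simp: PiE_def\<close>)
    qed
    show "\<forall>f\<in>N. ?sum (?split f) = f"
    proof
      fix f assume f: "f \<in> N"
      show "?sum (?split f) = f"
      proof (rule cat_ring_eqI)
        show "?sum (?split f) \<in> carrier ?R" "f \<in> carrier ?R"
          using subsetD[OF N(1)] sum_closed[OF split[OF f]] f by blast+
        show "?sum (?split f) (X, Y) = f (X, Y)" if "X \<in> Ob C" "Y \<in> Ob C" for X Y
          using sum_entry[OF split[OF f] that] that by (simp add: single_entry)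
      qed
    qed
    show "?sum ` ?D \<subseteq> N" using sum_closed by blast
    show "?split ` N \<subseteq> ?D" using split by blast
  qed
qed

text \<open>
  Every right submodule of \<open>1\<^sub>X R\<close> is graded: its elements are concentrated in row \<open>X\<close>, and the
  component of \<open>f\<close> of degree \<open>(X, Z)\<close> is \<open>f 1\<^sub>Z\<close>.
\<close>

lemma graded_submodules_right:
  assumes X: "X \<in> Ob C"
  shows "{N. graded_submodule N (cat_ring C) (right_module_at (cat_ring C) (X, X))} =
    {N. right_ideal (cat_ring C) N \<and> (\<forall>x\<in>N. unit_at (cat_ring C) (X, X) \<otimes>\<^bsub>cat_ring C\<^esub> x = x)}"
proof -
  let ?R = "cat_ring C" and ?u = "unit_at (cat_ring C) (X, X)"
  have sub: "submodule N ?R (right_module_at ?R (X, X)) \<longleftrightarrow>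
      right_ideal ?R N \<and> (\<forall>x\<in>N. ?u \<otimes>\<^bsub>?R\<^esub> x = x)" for N
    unfolding right_module_at_def
    using R.submodule_right_principal_iff unit_at_closed[OF X] unit_at_idem[OF X] by simp
  have "internal_direct_sum ?R (Ob C \<times> Ob C) (\<lambda>\<gamma>. N \<inter> homog ?R \<gamma>) N"
    if N: "right_ideal ?R N" "\<And>x. x \<in> N \<Longrightarrow> ?u \<otimes>\<^bsub>?R\<^esub> x = x" for N
  proof (rule internal_direct_sum_homog)
    note D = right_idealD[OF N(1)]
    fix f Y Z assume f: "f \<in> N" and YZ: "Y \<in> Ob C" "Z \<in> Ob C"
    have fR: "f \<in> carrier ?R" using D f by simp
    have row: "f (W, Z) = \<zero>\<^bsub>Mor C Z W\<^esub>" if "W \<in> Ob C" "W \<noteq> X" for W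
      using single_mult_entry[OF fR X X YZ(2) that(1) Ident_closed[OF X]] that N(2)[OF f]
      by (simp add: unit_at_cat_ring)
    show "single C (Y, Z) (f (Y, Z)) \<in> N"
    proof (cases "Y = X")
      case False
      then show ?thesis using row[of Y] YZ D(2) by (simp add: single_zero)
    next
      case True
      have "f \<otimes>\<^bsub>?R\<^esub> single C (Z, Z) (Ident C Z) = single C (X, Z) (f (X, Z))"
        by (rule cat_ring_eqI)
          (use fR X YZ row in \<open>auto simp: mult_single_entry single_entry single_closed entry_closed
            Ident_closed Ident_right Comp_zero_left mult_closed_cat_ring\<close>)
      moreover have "f \<otimes>\<^bsub>?R\<^esub> single C (Z, Z) (Ident C Z) \<in> N"
        using D(4)[OF f] YZ by (simp add: single_closed Ident_closed)
      ultimately show ?thesis using True by simp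
    qed
  qed (use right_idealD[OF N(1)] R.right_ideal_add[OF N(1)] in auto)
  then show ?thesis by (auto simp: graded_submodule_def sub base_cat_ring)
qed

text \<open>
  Here the elements are concentrated in column \<open>X\<close>, and the component of degree \<open>(Y, X)\<close> is \<open>1\<^sub>Y f\<close>.
\<close>

lemma graded_submodules_left:
  assumes X: "X \<in> Ob C"
  shows "{N. graded_submodule N (cat_ring C) (left_module_at (cat_ring C) (X, X))} =
    {N. right_ideal (opposite_ring (cat_ring C)) N \<and>
      (\<forall>x\<in>N. unit_at (cat_ring C) (X, X) \<otimes>\<^bsub>opposite_ring (cat_ring C)\<^esub> x = x)}"
proof -
  let ?R = "cat_ring C" and ?u = "unit_at (cat_ring C) (X, X)"
  interpret op: rng "opposite_ring ?R" by (rule rng_opposite_ring[OF rng_cat_ring])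
  have sub: "submodule N ?R (left_module_at ?R (X, X)) \<longleftrightarrow>
      right_ideal (opposite_ring ?R) N \<and> (\<forall>x\<in>N. ?u \<otimes>\<^bsub>opposite_ring ?R\<^esub> x = x)" for N
    unfolding left_module_at_def
    using R.submodule_left_principal_iff unit_at_closed[OF X] unit_at_idem[OF X] by simp
  have "internal_direct_sum ?R (Ob C \<times> Ob C) (\<lambda>\<gamma>. N \<inter> homog ?R \<gamma>) N"
    if N: "right_ideal (opposite_ring ?R) N" "\<And>x. x \<in> N \<Longrightarrow> x \<otimes>\<^bsub>?R\<^esub> ?u = x" for N
  proof (rule internal_direct_sum_homog)
    note D = right_idealD[OF N(1), simplified]
    fix f Y Z assume f: "f \<in> N" and YZ: "Y \<in> Ob C" "Z \<in> Ob C"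
    have fR: "f \<in> carrier ?R" using D f by simp
    have column: "f (Y, W) = \<zero>\<^bsub>Mor C W Y\<^esub>" if "W \<in> Ob C" "W \<noteq> X" for W
      using mult_single_entry[OF fR YZ(1) X X that(1) Ident_closed[OF X]] that N(2)[OF f]
      by (simp add: unit_at_cat_ring)
    show "single C (Y, Z) (f (Y, Z)) \<in> N"
    proof (cases "Z = X")
      case False
      then show ?thesis using column[of Z] YZ D(2) by (simp add: single_zero)
    next
      case True
      have "single C (Y, Y) (Ident C Y) \<otimes>\<^bsub>?R\<^esub> f = single C (Y, X) (f (Y, X))"
        by (rule cat_ring_eqI)
          (use fR X YZ column in \<open>auto simp: single_mult_entry single_entry single_closed entry_closed
            Ident_closed Ident_left Comp_zero_right mult_closed_cat_ring\<close>)
      moreover have "single C (Y, Y) (Ident C Y) \<otimes>\<^bsub>?R\<^esub> f \<in> N"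
        using D(4)[OF f] YZ by (simp add: single_closed Ident_closed)
      ultimately show ?thesis using True by simp
    qed
  qed (use right_idealD[OF N(1)] op.right_ideal_add[OF N(1)] in auto)
  then show ?thesis by (auto simp: graded_submodule_def sub base_cat_ring)
qed

text \<open>
  An element has finite support, so the sum of the \<open>1\<^sub>X\<close> over the finitely many objects \<open>X\<close> occurring
  in it is a two-sided local unit.
\<close>

lemma local_units_in_span:
  assumes \<epsilon>: "\<epsilon> \<in> carrier (cat_ring C)"
    and units: "\<And>X. X \<in> Ob C \<Longrightarrow> unit_at (cat_ring C) (X, X) \<in> span_through (cat_ring C) \<epsilon>"
    and r: "r \<in> carrier (cat_ring C)"
  shows "\<exists>e\<in>span_through (cat_ring C) \<epsilon>. e \<otimes>\<^bsub>cat_ring C\<^esub> r = r \<and> r \<otimes>\<^bsub>cat_ring C\<^esub> e = r"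
proof -
  obtain T where T: "finite T" "T \<subseteq> Ob C"
    "\<And>X Y. \<lbrakk> X \<in> Ob C; Y \<in> Ob C; X \<notin> T \<or> Y \<notin> T \<rbrakk> \<Longrightarrow> r (X, Y) = \<zero>\<^bsub>Mor C Y X\<^esub>"
    using cat_ring_support[OF r] by blast
  have "\<exists>e\<in>span_through (cat_ring C) \<epsilon>. \<forall>X\<in>Ob C. \<forall>Y\<in>Ob C.
      e (X, Y) = (if X = Y \<and> X \<in> T then Ident C X else \<zero>\<^bsub>Mor C Y X\<^esub>)"
    using T(1,2)
  proof induction
    case empty
    then show ?case by (auto simp: zero_entry intro!: bexI[OF _ span_through.zero])
  next
    case (insert Z T)
    then obtain e where e: "e \<in> span_through (cat_ring C) \<epsilon>" "\<And>X Y. \<lbrakk> X \<in> Ob C; Y \<in> Ob C \<rbrakk> \<Longrightarrow>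
      e (X, Y) = (if X = Y \<and> X \<in> T then Ident C X else \<zero>\<^bsub>Mor C Y X\<^esub>)" by auto
    show ?case
    proof (intro bexI ballI)
      show "unit_at (cat_ring C) (Z, Z) \<oplus>\<^bsub>cat_ring C\<^esub> e \<in> span_through (cat_ring C) \<epsilon>"
        using R.span_through_add[OF \<epsilon>] units e insert.prems by auto
      fix X Y assume XY: "X \<in> Ob C" "Y \<in> Ob C"
      interpret YX: abelian_group "Mor C Y X" using Mor_group XY by blast
      note units = YX.r_zero YX.l_zero YX.zero_closed Ident_closed[OF XY(1)]
      show "(unit_at (cat_ring C) (Z, Z) \<oplus>\<^bsub>cat_ring C\<^esub> e) (X, Y) =
          (if X = Y \<and> X \<in> insert Z T then Ident C X else \<zero>\<^bsub>Mor C Y X\<^esub>)"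
        using XY insert.hyps units
        by (cases "X = Y") (auto simp: add_entry unit_at_cat_ring single_entry e)
    qed
  qed
  then obtain e where e: "e \<in> span_through (cat_ring C) \<epsilon>" "\<And>X Y. \<lbrakk> X \<in> Ob C; Y \<in> Ob C \<rbrakk> \<Longrightarrow>
      e (X, Y) = (if X = Y \<and> X \<in> T then Ident C X else \<zero>\<^bsub>Mor C Y X\<^esub>)" by auto
  have eR: "e \<in> carrier (cat_ring C)" using R.span_through_closed[OF \<epsilon> e(1)] .
  have "e \<otimes>\<^bsub>cat_ring C\<^esub> r = r"
  proof (rule cat_ring_eqI)
    fix X Y assume XY: "X \<in> Ob C" "Y \<in> Ob C"
    have "(e \<otimes>\<^bsub>cat_ring C\<^esub> r) (X, Y) = Comp C Y X X (e (X, X)) (r (X, Y))"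
      using XY e(2) by (intro mult_entry_one_term eR r) auto
    then show "(e \<otimes>\<^bsub>cat_ring C\<^esub> r) (X, Y) = r (X, Y)"
      using XY r T(3)[OF XY] by (auto simp: e(2) Ident_left Comp_zero_left zero_closed_Mor entry_closed)
  qed (use eR r mult_closed_cat_ring in auto)
  moreover have "r \<otimes>\<^bsub>cat_ring C\<^esub> e = r"
  proof (rule cat_ring_eqI)
    fix X Y assume XY: "X \<in> Ob C" "Y \<in> Ob C"
    have "(r \<otimes>\<^bsub>cat_ring C\<^esub> e) (X, Y) = Comp C Y Y X (r (X, Y)) (e (Y, Y))"
      using XY e(2) by (intro mult_entry_one_term eR r) auto
    then show "(r \<otimes>\<^bsub>cat_ring C\<^esub> e) (X, Y) = r (X, Y)"
      using XY r T(3)[OF XY] by (auto simp: e(2) Ident_right Comp_zero_right zero_closed_Mor entry_closed)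
  qed (use eR r mult_closed_cat_ring in auto)
  ultimately show ?thesis using e(1) by blast
qed

end

section \<open>Dual bases of finitely generated projective modules\<close>

lemma rmod_homD:
  assumes "f \<in> rmod_hom A M N"
  shows "x \<in> carrier M \<Longrightarrow> f x \<in> carrier N" "f \<in> extensional (carrier M)"
    "\<lbrakk> x \<in> carrier M; y \<in> carrier M \<rbrakk> \<Longrightarrow> f (x \<oplus>\<^bsub>M\<^esub> y) = f x \<oplus>\<^bsub>N\<^esub> f y"
    "\<lbrakk> a \<in> carrier A; x \<in> carrier M \<rbrakk> \<Longrightarrow> f (a \<odot>\<^bsub>M\<^esub> x) = a \<odot>\<^bsub>N\<^esub> f x"
  using assms by (auto simp: rmod_hom_def PiE_def)

lemma right_regular_simps [simp]:
  "carrier (right_regular A) = carrier A" "a \<odot>\<^bsub>right_regular A\<^esub> x = x \<otimes>\<^bsub>A\<^esub> a"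
  "x \<oplus>\<^bsub>right_regular A\<^esub> y = x \<oplus>\<^bsub>A\<^esub> y" "\<zero>\<^bsub>right_regular A\<^esub> = \<zero>\<^bsub>A\<^esub>"
  by (simp_all add: right_regular_def)

lemma free_right_module_simps [simp]:
  "carrier (free_right_module A I) = {f \<in> I \<rightarrow>\<^sub>E carrier A. finite {i\<in>I. f i \<noteq> \<zero>\<^bsub>A\<^esub>}}"
  "\<zero>\<^bsub>free_right_module A I\<^esub> = (\<lambda>i\<in>I. \<zero>\<^bsub>A\<^esub>)"
  "f \<oplus>\<^bsub>free_right_module A I\<^esub> g = (\<lambda>i\<in>I. f i \<oplus>\<^bsub>A\<^esub> g i)"
  "a \<odot>\<^bsub>free_right_module A I\<^esub> f = (\<lambda>i\<in>I. f i \<otimes>\<^bsub>A\<^esub> a)"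
  by (simp_all add: free_right_module_def)

text \<open>
  Needed because projectivity is expressed through a complement inside a free module, and the
  projection onto the summand is well defined only by the group laws there.
\<close>

lemma right_module_free_right_module:
  assumes "ring A" shows "right_module A (free_right_module A I)"
proof -
  interpret ring A by fact
  let ?F = "free_right_module A I"
  have FI: "f \<in> carrier ?F"
    if "f \<in> I \<rightarrow>\<^sub>E carrier A" "finite K" "\<And>i. \<lbrakk> i \<in> I; i \<notin> K \<rbrakk> \<Longrightarrow> f i = \<zero>\<^bsub>A\<^esub>" for f K
  proof -
    have "{i\<in>I. f i \<noteq> \<zero>\<^bsub>A\<^esub>} \<subseteq> K" using that(3) by auto
    then have "finite {i\<in>I. f i \<noteq> \<zero>\<^bsub>A\<^esub>}" using that(2) by (rule finite_subset)
    then show ?thesis using that(1) by simp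
  qed
  have supp: "finite {i\<in>I. f i \<noteq> \<zero>\<^bsub>A\<^esub>}" if "f \<in> carrier ?F" for f using that by simp
  have el: "f i \<in> carrier A" if "f \<in> carrier ?F" "i \<in> I" for f i
    using that by auto
  have ext: "f = g" if "f \<in> carrier ?F" "g \<in> carrier ?F" "\<And>i. i \<in> I \<Longrightarrow> f i = g i" for f g
    by (rule PiE_ext[of f I "\<lambda>_. carrier A" g]) (use that in auto)
  have zero: "\<zero>\<^bsub>?F\<^esub> \<in> carrier ?F" by (rule FI[of _ "{}"]) auto
  have add: "f \<oplus>\<^bsub>?F\<^esub> g \<in> carrier ?F" if "f \<in> carrier ?F" "g \<in> carrier ?F" for f g
    by (rule FI[OF _ finite_UnI[OF supp[OF that(1)] supp[OF that(2)]]]) (use that el in auto)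
  have smult: "a \<odot>\<^bsub>?F\<^esub> f \<in> carrier ?F" if "a \<in> carrier A" "f \<in> carrier ?F" for a f
    by (rule FI[OF _ supp[OF that(2)]]) (use that el in auto)
  note [simp del] = free_right_module_simps(1)
  interpret F: abelian_group ?F
  proof (rule abelian_groupI)
    fix f assume f: "f \<in> carrier ?F"
    have "(\<lambda>i\<in>I. \<ominus>\<^bsub>A\<^esub> f i) \<in> carrier ?F"
      by (rule FI[OF _ supp[OF f]]) (use f el in auto)
    moreover have "(\<lambda>i\<in>I. \<ominus>\<^bsub>A\<^esub> f i) \<oplus>\<^bsub>?F\<^esub> f = \<zero>\<^bsub>?F\<^esub>"
      using f by (auto simp: l_neg el intro!: restrict_ext)
    ultimately show "\<exists>g\<in>carrier ?F. g \<oplus>\<^bsub>?F\<^esub> f = \<zero>\<^bsub>?F\<^esub>" by blast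
    show "\<zero>\<^bsub>?F\<^esub> \<oplus>\<^bsub>?F\<^esub> f = f"
      by (rule ext[OF add[OF zero f] f]) (use f el in auto)
  next
    show "f \<oplus>\<^bsub>?F\<^esub> g = g \<oplus>\<^bsub>?F\<^esub> f" if "f \<in> carrier ?F" "g \<in> carrier ?F" for f g
      using that by (auto simp: el a_comm intro!: restrict_ext)
    show "f \<oplus>\<^bsub>?F\<^esub> g \<oplus>\<^bsub>?F\<^esub> h = f \<oplus>\<^bsub>?F\<^esub> (g \<oplus>\<^bsub>?F\<^esub> h)"
      if "f \<in> carrier ?F" "g \<in> carrier ?F" "h \<in> carrier ?F" for f g h
      using that by (auto simp: el a_assoc intro!: restrict_ext)
  qed (use add zero in blast)+
  show ?thesis
  proof unfold_locales
    show "\<one>\<^bsub>A\<^esub> \<odot>\<^bsub>?F\<^esub> f = f" if "f \<in> carrier ?F" for f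
      by (rule ext[OF smult[OF one_closed that] that]) (use that el in auto)
  qed (use smult in \<open>auto simp: el l_distr r_distr m_assoc intro!: restrict_ext\<close>)
qed

text \<open>
  Let \<open>\<sigma>\<close> be the projection of the free module onto the summand, followed by the inverse of the
  isomorphism \<open>\<phi>\<close>. Then \<open>h\<^sub>i x\<close> is the \<open>i\<close>th coordinate of \<open>\<phi> x\<close>, and \<open>g\<^sub>i a\<close> is the image under
  \<open>\<sigma>\<close> of the \<open>i\<close>th basis vector times \<open>a\<close>. Applying \<open>\<sigma>\<close> to the expansion of \<open>\<phi> x\<close> in the basis
  gives \<open>x\<close>. The sum may run over any finite set containing the support of \<open>\<phi> x\<close>, so that one
  set can be used for several \<open>x\<close>.
\<close>

lemma dual_basis:
  fixes M :: "('a, 'b, 'x) module_scheme"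
  assumes M: "right_module A M" and proj: "projective A M"
  obtains I :: "'b set" and g h where
    "h \<in> I \<rightarrow> rmod_hom A M (right_regular A)" "g \<in> I \<rightarrow> rmod_hom A (right_regular A) M"
    "\<forall>x\<in>carrier M. finite {i\<in>I. h i x \<noteq> \<zero>\<^bsub>A\<^esub>}"
    "\<forall>x\<in>carrier M. \<forall>J. finite J \<and> J \<subseteq> I \<and> {i\<in>I. h i x \<noteq> \<zero>\<^bsub>A\<^esub>} \<subseteq> J \<longrightarrow>
      (\<Oplus>\<^bsub>M\<^esub>i\<in>J. g i (h i x)) = x"
proof -
  interpret M: right_module A M by fact
  obtain I :: "'b set" and P Q \<phi> where PQ: "submodule P A (free_right_module A I)"
      "submodule Q A (free_right_module A I)"
      "P <+>\<^bsub>free_right_module A I\<^esub> Q = carrier (free_right_module A I)"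
      "P \<inter> Q = {\<zero>\<^bsub>free_right_module A I\<^esub>}"
    and \<phi>: "\<phi> \<in> rmod_hom A M ((free_right_module A I)\<lparr>carrier := P\<rparr>)" "bij_betw \<phi> (carrier M) P"
    using proj unfolding projective_def Let_def by blast
  define F where "F = free_right_module A I"
  interpret F: right_module A F
    unfolding F_def by (rule right_module_free_right_module) (rule M.ring_axioms)
  interpret P: submodule P A F using PQ(1) by (simp add: F_def)
  interpret Q: submodule Q A F using PQ(2) by (simp add: F_def)
  have PF: "p \<in> carrier F" if "p \<in> P" for p using P.subset that by auto
  have QF: "q \<in> carrier F" if "q \<in> Q" for q using Q.subset that by auto
  have \<phi>P: "\<phi> x \<in> P" if "x \<in> carrier M" for x using rmod_homD(1)[OF \<phi>(1)] that by simp
  have \<phi>_add: "\<phi> (x \<oplus>\<^bsub>M\<^esub> y) = \<phi> x \<oplus>\<^bsub>F\<^esub> \<phi> y" if "x \<in> carrier M" "y \<in> carrier M" for x y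
    using rmod_homD(3)[OF \<phi>(1) that] by (simp add: F_def)
  have \<phi>_smult: "\<phi> (a \<odot>\<^bsub>M\<^esub> x) = a \<odot>\<^bsub>F\<^esub> \<phi> x" if "a \<in> carrier A" "x \<in> carrier M" for a x
    using rmod_homD(4)[OF \<phi>(1) that] by (simp add: F_def)
  define \<sigma> where "\<sigma> f = (THE x. x \<in> carrier M \<and> (\<exists>q\<in>Q. f = \<phi> x \<oplus>\<^bsub>F\<^esub> q))" for f
  have decomp: "\<exists>x\<in>carrier M. \<exists>q\<in>Q. f = \<phi> x \<oplus>\<^bsub>F\<^esub> q" if "f \<in> carrier F" for f
  proof -
    have "f \<in> P <+>\<^bsub>F\<^esub> Q" using that PQ(3) by (simp add: F_def)
    then obtain p q where "p \<in> P" "q \<in> Q" "f = p \<oplus>\<^bsub>F\<^esub> q" by (auto simp: set_add_def')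
    moreover from this obtain x where "x \<in> carrier M" "p = \<phi> x"
      using \<phi>(2) by (auto simp: bij_betw_def)
    ultimately show ?thesis by blast
  qed
  \<comment> \<open>two decompositions differ by an element of \<open>P \<inter> Q = {0}\<close>; hence the projection \<open>\<sigma>\<close> is well defined\<close>
  have unique: "x = y"
    if "x \<in> carrier M" "y \<in> carrier M" "q \<in> Q" "r \<in> Q" "\<phi> x \<oplus>\<^bsub>F\<^esub> q = \<phi> y \<oplus>\<^bsub>F\<^esub> r" for x y q r
  proof -
    have F: "\<phi> x \<in> carrier F" "\<phi> y \<in> carrier F" "q \<in> carrier F" "r \<in> carrier F"
      using that \<phi>P PF QF by auto
    define d where "d = r \<ominus>\<^bsub>F\<^esub> q"
    have dF: "d \<in> carrier F" using F by (simp add: d_def)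
    have "\<phi> x = (\<phi> x \<oplus>\<^bsub>F\<^esub> q) \<ominus>\<^bsub>F\<^esub> q" using F by (simp add: a_minus_def F.a_assoc F.r_neg)
    also have "\<dots> = \<phi> y \<oplus>\<^bsub>F\<^esub> d" using F that(5) by (simp add: a_minus_def d_def F.a_assoc)
    finally have x: "\<phi> x = d \<oplus>\<^bsub>F\<^esub> \<phi> y" using F dF F.a_comm by simp
    then have "d = \<phi> x \<ominus>\<^bsub>F\<^esub> \<phi> y" using F dF by (simp add: a_minus_def F.a_assoc F.r_neg)
    moreover have "\<phi> x \<ominus>\<^bsub>F\<^esub> \<phi> y \<in> P"
      using F.M.subgroup_iff_diff_closed[of P] P.subgroup_axioms \<phi>P that by blast
    moreover have "d \<in> Q"
      using F.M.subgroup_iff_diff_closed[of Q] Q.subgroup_axioms that unfolding d_def by blast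
    ultimately have "d = \<zero>\<^bsub>F\<^esub>" using PQ(4) unfolding F_def[symmetric] by blast
    then have "\<phi> x = \<phi> y" using x F by simp
    then show ?thesis using \<phi>(2) that by (auto simp: bij_betw_def inj_on_def)
  qed
  have \<sigma>I: "\<sigma> (\<phi> x \<oplus>\<^bsub>F\<^esub> q) = x" if "x \<in> carrier M" "q \<in> Q" for x q
    unfolding \<sigma>_def using that unique by (intro the_equality) blast+
  have \<sigma>_closed: "\<sigma> f \<in> carrier M" if "f \<in> carrier F" for f
    using decomp[OF that] \<sigma>I by fastforce
  have \<sigma>_add: "\<sigma> (f \<oplus>\<^bsub>F\<^esub> f') = \<sigma> f \<oplus>\<^bsub>M\<^esub> \<sigma> f'" if ff': "f \<in> carrier F" "f' \<in> carrier F" for f f'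
  proof -
    obtain x q where x: "x \<in> carrier M" "q \<in> Q" "f = \<phi> x \<oplus>\<^bsub>F\<^esub> q" using decomp ff' by blast
    obtain y r where y: "y \<in> carrier M" "r \<in> Q" "f' = \<phi> y \<oplus>\<^bsub>F\<^esub> r" using decomp ff' by blast
    have "f \<oplus>\<^bsub>F\<^esub> f' = \<phi> (x \<oplus>\<^bsub>M\<^esub> y) \<oplus>\<^bsub>F\<^esub> (q \<oplus>\<^bsub>F\<^esub> r)"
      using x y \<phi>P PF QF by (simp add: \<phi>_add F.a_ac)
    moreover have "q \<oplus>\<^bsub>F\<^esub> r \<in> Q" using Q.m_closed x y by simp
    ultimately show ?thesis using \<sigma>I x y by simp
  qed
  have \<sigma>_smult: "\<sigma> (a \<odot>\<^bsub>F\<^esub> f) = a \<odot>\<^bsub>M\<^esub> \<sigma> f" if af: "a \<in> carrier A" "f \<in> carrier F" for a f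
  proof -
    obtain x q where x: "x \<in> carrier M" "q \<in> Q" "f = \<phi> x \<oplus>\<^bsub>F\<^esub> q" using decomp af by blast
    then have "a \<odot>\<^bsub>F\<^esub> f = \<phi> (a \<odot>\<^bsub>M\<^esub> x) \<oplus>\<^bsub>F\<^esub> (a \<odot>\<^bsub>F\<^esub> q)"
      using af \<phi>P PF QF by (simp add: \<phi>_smult F.smult_distr_vector)
    then show ?thesis
      using \<sigma>I[of "a \<odot>\<^bsub>M\<^esub> x" "a \<odot>\<^bsub>F\<^esub> q"] \<sigma>I[of x q] x af M.smult_closed Q.smult_closed by simp
  qed
  have \<sigma>\<phi>: "\<sigma> (\<phi> x) = x" if "x \<in> carrier M" for x
    using \<sigma>I[OF that Q.one_closed] \<phi>P[OF that] PF by simp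
  define \<delta> where "\<delta> i a = (\<lambda>k\<in>I. if k = i then a else \<zero>\<^bsub>A\<^esub>)" for i a
  have \<delta>F: "\<delta> i a \<in> carrier F" if "a \<in> carrier A" for i a
  proof -
    have "{k\<in>I. \<delta> i a k \<noteq> \<zero>\<^bsub>A\<^esub>} \<subseteq> {i}" by (auto simp: \<delta>_def)
    then have "finite {k\<in>I. \<delta> i a k \<noteq> \<zero>\<^bsub>A\<^esub>}" using finite_subset by blast
    then show ?thesis using that by (auto simp: F_def \<delta>_def)
  qed
  define g where "g i = (\<lambda>a\<in>carrier A. \<sigma> (\<delta> i a))" for i
  define h where "h i = (\<lambda>x\<in>carrier M. \<phi> x i)" for i
  have \<phi>_entry: "\<phi> x i \<in> carrier A" if "x \<in> carrier M" "i \<in> I" for x i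
    using PF[OF \<phi>P[OF that(1)]] that by (auto simp: F_def)
  have h: "h i \<in> rmod_hom A M (right_regular A)" if i: "i \<in> I" for i
    by (rule rmod_homI)
      (use i \<phi>_entry \<phi>_add \<phi>_smult M.smult_closed in \<open>auto simp: h_def F_def\<close>)
  have g: "g i \<in> rmod_hom A (right_regular A) M" if i: "i \<in> I" for i
  proof (rule rmod_homI)
    fix a b assume ab: "a \<in> carrier (right_regular A)" "b \<in> carrier (right_regular A)"
    have "\<delta> i (a \<oplus>\<^bsub>A\<^esub> b) = \<delta> i a \<oplus>\<^bsub>F\<^esub> \<delta> i b"
      using ab by (auto simp: \<delta>_def F_def)
    then show "g i (a \<oplus>\<^bsub>right_regular A\<^esub> b) = g i a \<oplus>\<^bsub>M\<^esub> g i b"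
      using ab \<delta>F \<sigma>_add by (simp add: g_def)
  next
    fix a b assume ab: "a \<in> carrier A" "b \<in> carrier (right_regular A)"
    have "\<delta> i (b \<otimes>\<^bsub>A\<^esub> a) = a \<odot>\<^bsub>F\<^esub> \<delta> i b"
      using ab by (auto simp: \<delta>_def F_def)
    then show "g i (a \<odot>\<^bsub>right_regular A\<^esub> b) = a \<odot>\<^bsub>M\<^esub> g i b"
      using ab \<delta>F \<sigma>_smult by (simp add: g_def)
  qed (use \<delta>F \<sigma>_closed in \<open>auto simp: g_def\<close>)
  have expand: "(\<Oplus>\<^bsub>M\<^esub>i\<in>J. \<sigma> (\<delta> i (f i))) = \<sigma> f"
    if "finite J" "J \<subseteq> I" "f \<in> carrier F" "{i\<in>I. f i \<noteq> \<zero>\<^bsub>A\<^esub>} \<subseteq> J" for J f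
    using that
  proof (induction arbitrary: f)
    case empty
    then have "f = \<zero>\<^bsub>F\<^esub>" by (auto simp: F_def intro!: PiE_ext[of f I _ "\<lambda>i\<in>I. \<zero>\<^bsub>A\<^esub>"])
    moreover have "\<sigma> \<zero>\<^bsub>F\<^esub> = \<zero>\<^bsub>M\<^esub>"
      using \<sigma>_add[of "\<zero>\<^bsub>F\<^esub>" "\<zero>\<^bsub>F\<^esub>", symmetric] \<sigma>_closed[of "\<zero>\<^bsub>F\<^esub>"] M.add.r_cancel_one
      by simp
    ultimately show ?case by simp
  next
    case (insert i J)
    define f' where "f' = (\<lambda>k\<in>I. if k = i then \<zero>\<^bsub>A\<^esub> else f k)"
    have f: "f k \<in> carrier A" if "k \<in> I" for k using insert.prems that by (auto simp: F_def)
    have i: "i \<in> I" using insert.prems by simp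
    have sub: "{k\<in>I. f' k \<noteq> \<zero>\<^bsub>A\<^esub>} \<subseteq> J" using insert.prems by (auto simp: f'_def)
    then have "finite {k\<in>I. f' k \<noteq> \<zero>\<^bsub>A\<^esub>}" using insert.hyps finite_subset by blast
    then have f'F: "f' \<in> carrier F" using f by (auto simp: F_def f'_def)
    have "\<delta> i (f i) \<oplus>\<^bsub>F\<^esub> f' \<in> carrier F" using \<delta>F[OF f[OF i]] f'F by simp
    then have split: "f = \<delta> i (f i) \<oplus>\<^bsub>F\<^esub> f'"
      using insert.prems f i by (intro PiE_ext[of f I "\<lambda>_. carrier A"]) (auto simp: F_def \<delta>_def f'_def)
    have "(\<Oplus>\<^bsub>M\<^esub>k\<in>J. \<sigma> (\<delta> k (f k))) = (\<Oplus>\<^bsub>M\<^esub>k\<in>J. \<sigma> (\<delta> k (f' k)))"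
    proof (intro M.finsum_cong' refl)
      fix k assume k: "k \<in> J"
      then have "f' k = f k" using insert.hyps insert.prems by (auto simp: f'_def)
      then show "\<sigma> (\<delta> k (f k)) = \<sigma> (\<delta> k (f' k))" by simp
    next
      show "(\<lambda>k. \<sigma> (\<delta> k (f' k))) \<in> J \<rightarrow> carrier M"
        using insert.prems f \<sigma>_closed \<delta>F by (auto simp: f'_def)
    qed
    also have "\<dots> = \<sigma> f'" using insert.IH[OF _ f'F sub] insert.prems by simp
    finally have IH: "(\<Oplus>\<^bsub>M\<^esub>k\<in>J. \<sigma> (\<delta> k (f k))) = \<sigma> f'" .
    have "(\<Oplus>\<^bsub>M\<^esub>k\<in>insert i J. \<sigma> (\<delta> k (f k))) = \<sigma> (\<delta> i (f i)) \<oplus>\<^bsub>M\<^esub> \<sigma> f'"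
      using insert.hyps insert.prems f \<sigma>_closed \<delta>F IH
      by (subst M.finsum_insert) (auto simp: subset_iff)
    also have "\<dots> = \<sigma> (\<delta> i (f i) \<oplus>\<^bsub>F\<^esub> f')"
      by (rule \<sigma>_add[OF \<delta>F[OF f[OF i]] f'F, symmetric])
    also have "\<dots> = \<sigma> f" by (rule arg_cong[OF split[symmetric]])
    finally show ?case .
  qed
  show ?thesis
  proof (rule that[of h I g]; (intro ballI allI impI)?)
    show "h \<in> I \<rightarrow> rmod_hom A M (right_regular A)" "g \<in> I \<rightarrow> rmod_hom A (right_regular A) M"
      using g h by auto
  next
    fix x assume x: "x \<in> carrier M"
    have \<phi>x: "\<phi> x \<in> carrier F" using \<phi>P PF x by blast
    have h\<phi>: "h i x = \<phi> x i" for i using x by (simp add: h_def)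
    show "finite {i\<in>I. h i x \<noteq> \<zero>\<^bsub>A\<^esub>}" using \<phi>x by (simp add: h\<phi> F_def)
    fix J assume J: "finite J \<and> J \<subseteq> I \<and> {i\<in>I. h i x \<noteq> \<zero>\<^bsub>A\<^esub>} \<subseteq> J"
    have "(\<Oplus>\<^bsub>M\<^esub>i\<in>J. g i (h i x)) = (\<Oplus>\<^bsub>M\<^esub>i\<in>J. \<sigma> (\<delta> i (\<phi> x i)))"
      using J x \<phi>_entry \<sigma>_closed \<delta>F by (intro M.finsum_cong') (auto simp: g_def h\<phi> subset_iff)
    also have "\<dots> = x" using expand[OF _ _ \<phi>x, of J] J \<sigma>\<phi>[OF x] by (simp add: h\<phi>)
    finally show "(\<Oplus>\<^bsub>M\<^esub>i\<in>J. g i (h i x)) = x" .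
  qed
qed

text \<open>
  The elements whose coordinates vanish outside a fixed set of indices form a submodule. If that set
  contains the supports of finitely many generators, it serves for all elements.
\<close>

lemma finite_dual_basis:
  fixes M :: "('a, 'b, 'x) module_scheme"
  assumes M: "right_module A M" and proj: "projective A M" and fg: "finitely_generated A M"
  obtains J :: "'b set" and g h where "finite J"
    "h \<in> J \<rightarrow> rmod_hom A M (right_regular A)" "g \<in> J \<rightarrow> rmod_hom A (right_regular A) M"
    "\<forall>x\<in>carrier M. (\<Oplus>\<^bsub>M\<^esub>i\<in>J. g i (h i x)) = x"
proof -
  interpret M: right_module A M by fact
  interpret A': rng A by (rule M.rng)
  obtain I :: "'b set" and g h where hI: "h \<in> I \<rightarrow> rmod_hom A M (right_regular A)"
    and g: "g \<in> I \<rightarrow> rmod_hom A (right_regular A) M"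
    and fin: "\<forall>x\<in>carrier M. finite {i\<in>I. h i x \<noteq> \<zero>\<^bsub>A\<^esub>}"
    and sum: "\<forall>x\<in>carrier M. \<forall>J. finite J \<and> J \<subseteq> I \<and> {i\<in>I. h i x \<noteq> \<zero>\<^bsub>A\<^esub>} \<subseteq> J \<longrightarrow>
      (\<Oplus>\<^bsub>M\<^esub>i\<in>J. g i (h i x)) = x"
    by (rule dual_basis[OF M proj])
  have h: "h i \<in> rmod_hom A M (right_regular A)" if "i \<in> I" for i using hI that by auto
  obtain S where S: "finite S" "S \<subseteq> carrier M"
    "\<And>N. \<lbrakk> submodule N A M; S \<subseteq> N \<rbrakk> \<Longrightarrow> N = carrier M"
    using fg unfolding finitely_generated_def by blast
  define J where "J = (\<Union>s\<in>S. {i\<in>I. h i s \<noteq> \<zero>\<^bsub>A\<^esub>})"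
  define N where "N = {x\<in>carrier M. \<forall>i\<in>I - J. h i x = \<zero>\<^bsub>A\<^esub>}"
  have h_minus: "h i (x \<ominus>\<^bsub>M\<^esub> y) = h i x \<ominus>\<^bsub>A\<^esub> h i y"
    if "i \<in> I" "x \<in> carrier M" "y \<in> carrier M" for i x y
  proof -
    have "(x \<ominus>\<^bsub>M\<^esub> y) \<oplus>\<^bsub>M\<^esub> y = x" using that by (simp add: a_minus_def M.a_assoc M.M.l_neg)
    then have "h i (x \<ominus>\<^bsub>M\<^esub> y) \<oplus>\<^bsub>A\<^esub> h i y = h i x"
      using rmod_homD(3)[OF h[OF that(1)], of "x \<ominus>\<^bsub>M\<^esub> y" y] that by simp
    then show ?thesis
      using rmod_homD(1)[OF h[OF that(1)]] that by (intro A'.minus_unique) auto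
  qed
  have h_zero: "h i \<zero>\<^bsub>M\<^esub> = \<zero>\<^bsub>A\<^esub>" if "i \<in> I" for i
  proof -
    have "\<zero>\<^bsub>M\<^esub> \<ominus>\<^bsub>M\<^esub> \<zero>\<^bsub>M\<^esub> = \<zero>\<^bsub>M\<^esub>"
      unfolding a_minus_def by (rule M.M.r_neg[OF M.M.zero_closed])
    then have "h i \<zero>\<^bsub>M\<^esub> = h i \<zero>\<^bsub>M\<^esub> \<ominus>\<^bsub>A\<^esub> h i \<zero>\<^bsub>M\<^esub>"
      using h_minus[OF that M.M.zero_closed M.M.zero_closed] by simp
    also have "\<dots> = \<zero>\<^bsub>A\<^esub>"
      using rmod_homD(1)[OF h[OF that], of "\<zero>\<^bsub>M\<^esub>"] by (simp add: A'.minus_self)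
    finally show ?thesis .
  qed
  have "submodule N A M"
  proof (rule submodule.intro)
    show "subgroup N (add_monoid M)"
      unfolding M.M.subgroup_iff_diff_closed by (auto simp: N_def h_zero h_minus A'.minus_self)
    show "submodule_axioms N A M"
      by (rule submodule_axioms.intro)
        (auto simp: N_def M.smult_closed rmod_homD(4)[OF h])
  qed
  moreover have "S \<subseteq> N" using S(2) by (auto simp: N_def J_def)
  ultimately have N: "N = carrier M" by (rule S(3))
  have J: "finite J" "J \<subseteq> I" using S(1,2) fin by (auto simp: J_def)
  have "{i\<in>I. h i x \<noteq> \<zero>\<^bsub>A\<^esub>} \<subseteq> J" if "x \<in> carrier M" for x
    using that unfolding N[symmetric] by (auto simp: N_def)
  then have "\<forall>x\<in>carrier M. (\<Oplus>\<^bsub>M\<^esub>i\<in>J. g i (h i x)) = x" using sum J by blast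
  moreover have "h \<in> J \<rightarrow> rmod_hom A M (right_regular A)" "g \<in> J \<rightarrow> rmod_hom A (right_regular A) M"
    using hI g J(2) by auto
  ultimately show ?thesis using that J(1) by blast
qed

section \<open>Categories of finitely generated projective modules\<close>

lemma full_subcategory_simps [simp]:
  "Ob (full_subcategory C S) = S" "Mor (full_subcategory C S) = Mor C"
  "Comp (full_subcategory C S) = Comp C" "Ident (full_subcategory C S) = Ident C"
  by (simp_all add: full_subcategory_def)

lemma proj_cat_simps [simp]:
  "Mor (proj_cat A) = hom_group A" "Comp (proj_cat A) M N P g f = compose (carrier M) g f"
  "Ident (proj_cat A) M = (\<lambda>x\<in>carrier M. x)"
  by (simp_all add: proj_cat_def)

lemma hom_group_simps [simp]:
  "carrier (hom_group A M N) = rmod_hom A M N"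
  "\<zero>\<^bsub>hom_group A M N\<^esub> = (\<lambda>x\<in>carrier M. \<zero>\<^bsub>N\<^esub>)"
  "f \<oplus>\<^bsub>hom_group A M N\<^esub> g = (\<lambda>x\<in>carrier M. f x \<oplus>\<^bsub>N\<^esub> g x)"
  by (simp_all add: hom_group_def)

lemma left_mult_rmod_hom:
  assumes "ring A" "a \<in> carrier A"
  shows "(\<lambda>x\<in>carrier A. a \<otimes>\<^bsub>A\<^esub> x) \<in> rmod_hom A (right_regular A) (right_regular A)"
proof -
  interpret ring A by fact
  show ?thesis by (rule rmod_homI) (use assms(2) in \<open>auto simp: r_distr m_assoc\<close>)
qed

text \<open>
  An endomorphism of \<open>A\<^sub>A\<close> is determined by the image of \<open>1\<close>.
\<close>

lemma rmod_hom_right_regular_eq_left_mult: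
  assumes "ring A" and f: "f \<in> rmod_hom A (right_regular A) (right_regular A)"
  shows "f = (\<lambda>x\<in>carrier A. f \<one>\<^bsub>A\<^esub> \<otimes>\<^bsub>A\<^esub> x)"
proof -
  interpret ring A by fact
  have eq: "f x = f \<one>\<^bsub>A\<^esub> \<otimes>\<^bsub>A\<^esub> x" if "x \<in> carrier A" for x
    using rmod_homD(4)[OF f that, of "\<one>\<^bsub>A\<^esub>"] that by simp
  have "f \<in> extensional (carrier A)" using rmod_homD(2)[OF f] by simp
  then show ?thesis by (rule extensionalityI) (simp_all add: eq[symmetric])
qed

locale proj_subcategory = ring A for A :: "('a, 'z) ring_scheme" (structure) +
  fixes S :: "('a, 'a) module set" and C
  assumes objects: "S \<subseteq> Ob (proj_cat A)" and regular: "right_regular A \<in> S"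
  defines "C \<equiv> full_subcategory (proj_cat A) S"
begin

sublocale preadditive_category C
  unfolding C_def by (rule preadditive_category_full_subcategory_proj_cat[OF objects])

lemma C_simps [simp]:
  "Ob C = S" "Mor C = hom_group A" "Comp C M N P g f = compose (carrier M) g f"
  "Ident C M = (\<lambda>x\<in>carrier M. x)"
  by (simp_all add: C_def)

abbreviation regular_module ("\<A>") where "\<A> \<equiv> right_regular A"

definition corner_emb :: "'a \<Rightarrow> ('a, 'a) module \<times> ('a, 'a) module \<Rightarrow> 'a \<Rightarrow> 'a" where
  "corner_emb a = single C (\<A>, \<A>) (\<lambda>x\<in>carrier A. a \<otimes> x)"

lemma corner_emb_closed: "a \<in> carrier A \<Longrightarrow> corner_emb a \<in> carrier (cat_ring C)"
  unfolding corner_emb_def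
  using single_closed[of \<A> \<A>] regular left_mult_rmod_hom[OF ring_axioms] by simp

lemma corner_emb_one: "corner_emb \<one> = unit_at (cat_ring C) (\<A>, \<A>)"
proof -
  have "(\<lambda>x\<in>carrier A. \<one> \<otimes> x) = (\<lambda>x\<in>carrier A. x)" by (rule restrict_ext) simp
  then show ?thesis by (simp add: corner_emb_def unit_at_cat_ring)
qed

text \<open>
  A finite dual basis \<open>id = \<Sum> g\<^sub>i \<circ> h\<^sub>i\<close> with \<open>h\<^sub>i : M \<rightarrow> A\<close> and \<open>g\<^sub>i : A \<rightarrow> M\<close> becomes
  \<open>1\<^sub>M = \<Sum> g\<^sub>i \<epsilon> h\<^sub>i\<close> in the ring of the category. The induction over the partial sums carries along
  that they are homomorphisms, as only then addition of matrix units applies.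
\<close>

lemma unit_at_in_span:
  assumes M: "M \<in> S"
  shows "unit_at (cat_ring C) (M, M) \<in> span_through (cat_ring C) (corner_emb \<one>)"
proof -
  have mod: "right_module A M" "projective A M" "finitely_generated A M"
    using M objects by (auto simp: proj_cat_def)
  interpret M: right_module A M by (rule mod(1))
  obtain J :: "'a set" and g h where J: "finite J"
    and hg: "h \<in> J \<rightarrow> rmod_hom A M \<A>" "g \<in> J \<rightarrow> rmod_hom A \<A> M"
    and sum: "\<forall>x\<in>carrier M. (\<Oplus>\<^bsub>M\<^esub>i\<in>J. g i (h i x)) = x"
    by (rule finite_dual_basis[OF mod])
  have h: "h i \<in> rmod_hom A M \<A>" and g: "g i \<in> rmod_hom A \<A> M" if "i \<in> J" for i
    using hg that by auto
  have gh: "g i (h i x) \<in> carrier M" if "i \<in> J" "x \<in> carrier M" for i x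
    using rmod_homD(1)[OF h[OF that(1)] that(2)] rmod_homD(1)[OF g[OF that(1)]] by simp
  define partial_sum where "partial_sum K = (\<lambda>x\<in>carrier M. \<Oplus>\<^bsub>M\<^esub>i\<in>K. g i (h i x))" for K
  have "partial_sum K \<in> rmod_hom A M M \<and>
      single C (M, M) (partial_sum K)
        \<in> span_through (cat_ring C) (corner_emb \<one>)" if "finite K" "K \<subseteq> J" for K
    using that
  proof induction
    case empty
    have "partial_sum {} = \<zero>\<^bsub>Mor C M M\<^esub>" by (simp add: partial_sum_def)
    moreover have "\<zero>\<^bsub>Mor C M M\<^esub> \<in> rmod_hom A M M" using zero_closed_Mor[of M M] M by simp
    moreover have "single C (M, M) \<zero>\<^bsub>Mor C M M\<^esub> = \<zero>\<^bsub>cat_ring C\<^esub>"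
      by (rule single_zero) (use M in simp_all)
    ultimately show ?case using span_through.zero[of "cat_ring C" "corner_emb \<one>"] by metis
  next
    case (insert i K)
    have i: "i \<in> J" using insert.prems by simp
    have hC: "h i \<in> carrier (Mor C M \<A>)" and gC: "g i \<in> carrier (Mor C \<A> M)"
      using h[OF i] g[OF i] by simp_all
    have ghC: "compose (carrier M) (g i) (h i) \<in> carrier (Mor C M M)"
      using Comp_closed[of M \<A> M "h i" "g i"] hC gC M regular by simp
    have fC: "partial_sum K \<in> carrier (Mor C M M)" using insert by simp
    have eq: "partial_sum (insert i K) =
        compose (carrier M) (g i) (h i) \<oplus>\<^bsub>Mor C M M\<^esub> partial_sum K"
      using insert.hyps insert.prems gh
      by (auto simp: partial_sum_def compose_def subset_iff intro!: restrict_ext M.finsum_insert)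
    have "single C (M, \<A>) (g i) \<otimes>\<^bsub>cat_ring C\<^esub>
        (corner_emb \<one> \<otimes>\<^bsub>cat_ring C\<^esub> single C (\<A>, M) (h i)) =
        single C (M, M) (compose (carrier M) (g i) (h i))"
      using M regular hC gC Ident_closed[of \<A>] Ident_left[of M \<A> "h i"]
      by (simp add: corner_emb_one unit_at_cat_ring single_mult_single del: C_simps(4))
    then have "single C (M, M) (partial_sum (insert i K)) =
        single C (M, \<A>) (g i) \<otimes>\<^bsub>cat_ring C\<^esub>
          (corner_emb \<one> \<otimes>\<^bsub>cat_ring C\<^esub> single C (\<A>, M) (h i)) \<oplus>\<^bsub>cat_ring C\<^esub> single C (M, M) (partial_sum K)"
      unfolding eq using single_add[OF _ _ ghC fC] M by simp
    moreover have "\<dots> \<in> span_through (cat_ring C) (corner_emb \<one>)"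
      using insert M regular hC gC by (intro span_through.add single_closed) auto
    moreover have "partial_sum (insert i K) \<in> carrier (Mor C M M)"
      unfolding eq
      using Mor_group[of M M] M ghC fC abelian_group.axioms(1) abelian_monoid.a_closed C_simps(1)
      by metis
    ultimately show ?case by simp
  qed
  from this[OF J order_refl]
  have "single C (M, M) (partial_sum J)
      \<in> span_through (cat_ring C) (corner_emb \<one>)" by blast
  moreover have "partial_sum J = Ident C M"
    using sum by (auto simp: partial_sum_def intro!: restrict_ext)
  ultimately show ?thesis by (simp add: unit_at_cat_ring del: C_simps(4))
qed

text \<open>
  The corner \<open>\<epsilon> R \<epsilon>\<close> consists of the matrices with a single entry, an endomorphism of \<open>A\<^sub>A\<close>, in degree
  \<open>(A, A)\<close>; these endomorphisms are the left multiplications.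
\<close>

sublocale full_corner "cat_ring C" A corner_emb
proof -
  interpret R: rng "cat_ring C" by (rule rng_cat_ring)
  have L: "(\<lambda>x\<in>carrier A. a \<otimes> x) \<in> carrier (Mor C \<A> \<A>)" if "a \<in> carrier A" for a
    using left_mult_rmod_hom[OF ring_axioms that] by simp
  show "full_corner (cat_ring C) A corner_emb"
  proof unfold_locales
    fix a b assume ab: "a \<in> carrier A" "b \<in> carrier A"
    have "(\<lambda>x\<in>carrier A. (a \<oplus> b) \<otimes> x) = (\<lambda>x\<in>carrier A. a \<otimes> x) \<oplus>\<^bsub>Mor C \<A> \<A>\<^esub> (\<lambda>x\<in>carrier A. b \<otimes> x)"
      using ab by (auto simp: l_distr intro!: restrict_ext)
    then have "corner_emb (a \<oplus> b) = single C (\<A>, \<A>)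
        ((\<lambda>x\<in>carrier A. a \<otimes> x) \<oplus>\<^bsub>Mor C \<A> \<A>\<^esub> (\<lambda>x\<in>carrier A. b \<otimes> x))"
      by (simp only: corner_emb_def)
    also have "\<dots> = corner_emb a \<oplus>\<^bsub>cat_ring C\<^esub> corner_emb b"
      unfolding corner_emb_def by (rule single_add) (use L ab regular in simp_all)
    finally show "corner_emb (a \<oplus> b) = corner_emb a \<oplus>\<^bsub>cat_ring C\<^esub> corner_emb b" .
    have "(\<lambda>x\<in>carrier A. (a \<otimes> b) \<otimes> x) =
        Comp C \<A> \<A> \<A> (\<lambda>x\<in>carrier A. a \<otimes> x) (\<lambda>x\<in>carrier A. b \<otimes> x)"
      using ab by (auto simp: m_assoc compose_def intro!: restrict_ext)
    then have "corner_emb (a \<otimes> b) = single C (\<A>, \<A>)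
        (Comp C \<A> \<A> \<A> (\<lambda>x\<in>carrier A. a \<otimes> x) (\<lambda>x\<in>carrier A. b \<otimes> x))"
      by (simp only: corner_emb_def)
    also have "\<dots> = corner_emb a \<otimes>\<^bsub>cat_ring C\<^esub> corner_emb b"
      unfolding corner_emb_def by (rule single_mult_single[symmetric]) (use L ab regular in simp_all)
    finally show "corner_emb (a \<otimes> b) = corner_emb a \<otimes>\<^bsub>cat_ring C\<^esub> corner_emb b" .
  next
    show "inj_on corner_emb (carrier A)"
    proof (rule inj_onI)
      fix a b assume ab: "a \<in> carrier A" "b \<in> carrier A" "corner_emb a = corner_emb b"
      then have "corner_emb a (\<A>, \<A>) \<one> = corner_emb b (\<A>, \<A>) \<one>" by simp
      then show "a = b" using ab(1,2) regular by (simp add: corner_emb_def single_entry)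
    qed
  next
    fix r assume r: "r \<in> carrier (cat_ring C)"
    then have rA: "r (\<A>, \<A>) \<in> rmod_hom A \<A> \<A>" using entry_closed[OF r, of \<A> \<A>] regular by simp
    let ?a = "r (\<A>, \<A>) \<one>"
    have a: "?a \<in> carrier A" using rmod_homD(1)[OF rA] by simp
    have eq: "(\<lambda>x\<in>carrier A. ?a \<otimes> x) = r (\<A>, \<A>)"
      using rmod_hom_right_regular_eq_left_mult[OF ring_axioms rA] by simp
    let ?u = "unit_at (cat_ring C) (\<A>, \<A>)"
    have "single C (\<A>, \<A>) (r (\<A>, \<A>)) = ?u \<otimes>\<^bsub>cat_ring C\<^esub> (r \<otimes>\<^bsub>cat_ring C\<^esub> ?u)"
    proof (rule cat_ring_eqI)
      fix X Y assume XY: "X \<in> Ob C" "Y \<in> Ob C"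
      show "single C (\<A>, \<A>) (r (\<A>, \<A>)) (X, Y) = (?u \<otimes>\<^bsub>cat_ring C\<^esub> (r \<otimes>\<^bsub>cat_ring C\<^esub> ?u)) (X, Y)"
        using XY r regular Ident_closed[of \<A>] Ident_left[of \<A> \<A>] Ident_right[of \<A> \<A>] Comp_zero_right[of Y \<A> \<A>]
          entry_closed[OF r, of \<A> \<A>]
        by (auto simp: unit_at_cat_ring single_mult_entry mult_single_entry single_entry
            mult_closed_cat_ring single_closed simp del: C_simps(2-4))
    qed (use r rA regular unit_at_closed[of \<A>] in \<open>auto intro!: single_closed mult_closed_cat_ring\<close>)
    then show "\<exists>a\<in>carrier A. corner_emb a =
        corner_emb \<one> \<otimes>\<^bsub>cat_ring C\<^esub> (r \<otimes>\<^bsub>cat_ring C\<^esub> corner_emb \<one>)"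
      using a eq by (intro bexI[of _ ?a]) (simp_all add: corner_emb_one, simp add: corner_emb_def)
    show "\<exists>e\<in>span_through (cat_ring C) (corner_emb \<one>). e \<otimes>\<^bsub>cat_ring C\<^esub> r = r \<and> r \<otimes>\<^bsub>cat_ring C\<^esub> e = r"
      using unit_at_in_span r corner_emb_closed[of \<one>] by (intro local_units_in_span) auto
  qed (use corner_emb_closed in auto)
qed

lemma chain_conditions:
  shows "right_gr_artinian (cat_ring C) \<longleftrightarrow> right_artinian A"
    and "right_gr_noetherian (cat_ring C) \<longleftrightarrow> right_noetherian A"
    and "left_gr_artinian (cat_ring C) \<longleftrightarrow> left_artinian A"
    and "left_gr_noetherian (cat_ring C) \<longleftrightarrow> left_noetherian A"
proof -
  interpret op: full_corner "opposite_ring (cat_ring C)" "opposite_ring A" corner_emb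
    by (rule full_corner_opposite)
  let ?U = "(\<lambda>X. unit_at (cat_ring C) (X, X)) ` S"
  have ids: "groupoid_ids (base (cat_ring C)) = (\<lambda>X. (X, X)) ` S"
    by (auto simp: groupoid_ids_def base_cat_ring)
  have U: "?U \<subseteq> carrier (cat_ring C)" "corner_emb \<one> \<in> ?U"
    using unit_at_closed regular by (auto simp: corner_emb_one)
  note right = right_chain_conditions[OF U]
  note left = op.right_chain_conditions[of ?U, simplified opposite_ring_simps, OF U]
  have reg: "{I. submodule I A (right_regular A)} = {I. right_ideal A I}"
    "{I. submodule I A (left_regular A)} = {I. right_ideal (opposite_ring A) I}"
    using submodule_right_regular_iff submodule_left_regular_iff ring.is_abelian_group[OF ring_axioms]
    by auto
  show "right_gr_artinian (cat_ring C) \<longleftrightarrow> right_artinian A"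
    "right_gr_noetherian (cat_ring C) \<longleftrightarrow> right_noetherian A"
    using right by (simp_all add: right_gr_artinian_def right_gr_noetherian_def right_artinian_def
        right_noetherian_def ids reg graded_submodules_right)
  show "left_gr_artinian (cat_ring C) \<longleftrightarrow> left_artinian A"
    "left_gr_noetherian (cat_ring C) \<longleftrightarrow> left_noetherian A"
    using left by (simp_all add: left_gr_artinian_def left_gr_noetherian_def left_artinian_def
        left_noetherian_def ids reg graded_submodules_left)
qed

end

theorem proposition3p31:
  fixes A :: "('a, 'z) ring_scheme"
    and C\<^sub>0 :: "('a, 'a) module set"
  assumes "ring A"
    and "C\<^sub>0 \<subseteq> Ob (proj_cat A)"
    and "right_regular A \<in> C\<^sub>0"
    and C: "C = full_subcategory (proj_cat A) C\<^sub>0"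
  shows "((right_gr_artinian (cat_ring C) \<longleftrightarrow> right_artinian A) \<and>
          (right_gr_noetherian (cat_ring C) \<longleftrightarrow> right_noetherian A)) \<and>
         ((left_gr_artinian (cat_ring C) \<longleftrightarrow> left_artinian A) \<and>
          (left_gr_noetherian (cat_ring C) \<longleftrightarrow> left_noetherian A))"
proof -
  interpret proj_subcategory A C\<^sub>0 C
    by (intro proj_subcategory.intro proj_subcategory_axioms.intro assms) (simp add: C)
  show ?thesis using chain_conditions by blast
qed

end
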